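(* Let $\mu_1$ be the largest eigenvalue of $M_{n,m}$ (the normalized tridiagonal Laguerre orthogonal ensemble matrix), and let $\widetilde\mu_1$ be the largest eigenvalue of the bottom-right $p\times p$ minor (submatrix formed by the last $p$ rows and columns) of $M_{n,m}$, where $p=p_n$ satisfies $2n^{1/3}(\log n)^3<p\le n$. Then, for any $D>0$ and $\varepsilon>0$, with probability at least $1-\varepsilon$ (for $n$ sufficiently large), $$|\mu_1-\widetilde\mu_1|=O(n^{-D}).$$ Furthermore, setting $$T_{2n}=\frac{n^{2/3}(\mu_1-d_+)}{\sqrt\lambda(1+\sqrt\lambda)^{4/3}},\qquad Y_n=\frac{n^{2/3}(\widetilde\mu_1-d_+)}{\sqrt\lambda(1+\sqrt\lambda)^{4/3}},$$ and taking $D>\frac23$ arbitrarily large, one has (with probability at least $1-\varepsilon$) $T_{2n}=Y_n+O(n^{-D+2/3})$.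
   Context: Standing assumptions: $n\le m$, $n,m\to\infty$ with $n/m=\lambda+O(n^{-1})$ for a constant $\lambda\in(0,1]$; $d_+=(1+\lambda^{1/2})^2$. The matrix $M_{n,m}=\frac1mBB^T$ is the normalized tridiagonal representation of the $n\times n$ Laguerre orthogonal ensemble: $B$ is the $n\times n$ lower bidiagonal matrix with diagonal entries $a_1,\dots,a_n$ and subdiagonal entries $b_1,\dots,b_{n-1}$ ($B_{ii}=a_i$, $B_{i+1,i}=b_i$), where all $a_i,b_i$ are independent nonnegative random variables with $a_i^2\sim\chi^2(m-n+i)$ and $b_i^2\sim\chi^2(i)$. Thus $mM_{n,m}$ is symmetric tridiagonal with diagonal entries $a_1^2,\,a_2^2+b_1^2,\dots,a_n^2+b_{n-1}^2$ and off-diagonal entries $a_jb_j$, $1\le j\le n-1$. *)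

theory Defs
  imports
    "HOL-Probability.Probability"
    "HOL-Library.Landau_Symbols"
    "Jordan_Normal_Form.Char_Poly"
    "Jordan_Normal_Form.DL_Submatrix"
begin

definition chi_square_density :: "nat \<Rightarrow> real \<Rightarrow> real" where
  "chi_square_density k x =
     (if x > 0
      then x powr (real k / 2 - 1) * exp (- x / 2) / (2 powr (real k / 2) * Gamma (real k / 2))
      else 0)"

text \<open>The coefficient sequences \<open>a\<close>, \<open>b\<close> are indexed from 1, matrix positions from 0.\<close>

definition lower_bidiagonal :: "nat \<Rightarrow> (nat \<Rightarrow> real) \<Rightarrow> (nat \<Rightarrow> real) \<Rightarrow> real mat" where
  "lower_bidiagonal n a b =
     mat n n (\<lambda>(i, j). if i = j then a (Suc i) else if i = Suc j then b (Suc j) else 0)"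

definition LOE_tridiagonal ::
    "nat \<Rightarrow> nat \<Rightarrow> (nat \<Rightarrow> real) \<Rightarrow> (nat \<Rightarrow> real) \<Rightarrow> real mat" where
  "LOE_tridiagonal n m a b =
     (1 / real m) \<cdot>\<^sub>m (lower_bidiagonal n a b * transpose_mat (lower_bidiagonal n a b))"

text \<open>Independence is joint independence of the whole family \<open>a\<^sub>1, \<dots>, a\<^sub>n, b\<^sub>1, \<dots>, b\<^sub>n\<^sub>-\<^sub>1\<close>,
  indexed by a disjoint sum.\<close>

definition LOE_entries ::
    "nat \<Rightarrow> nat \<Rightarrow> 'w measure \<Rightarrow> (nat \<Rightarrow> 'w \<Rightarrow> real) \<Rightarrow> (nat \<Rightarrow> 'w \<Rightarrow> real) \<Rightarrow> bool" where
  "LOE_entries n m M a b \<longleftrightarrow>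
     prob_space M \<and>
     prob_space.indep_vars M (\<lambda>_. borel) (case_sum a b) ({1..n} <+> {1..n - 1}) \<and>
     (\<forall>i\<in>{1..n}. (\<forall>w\<in>space M. 0 \<le> a i w) \<and>
        distributed M lborel (\<lambda>w. (a i w)\<^sup>2) (chi_square_density (m - n + i))) \<and>
     (\<forall>i\<in>{1..n - 1}. (\<forall>w\<in>space M. 0 \<le> b i w) \<and>
        distributed M lborel (\<lambda>w. (b i w)\<^sup>2) (chi_square_density i))"

definition largest_eigenvalue :: "real mat \<Rightarrow> real" where
  "largest_eigenvalue A = Max {x. eigenvalue A x}"

definition bottom_right_minor :: "nat \<Rightarrow> 'a mat \<Rightarrow> 'a mat" where
  "bottom_right_minor p A =
     submatrix A {dim_row A - p..<dim_row A} {dim_col A - p..<dim_col A}"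

definition d_plus :: "real \<Rightarrow> real" where
  "d_plus l = (1 + l powr (1/2))\<^sup>2"

definition edge_scaling :: "real \<Rightarrow> nat \<Rightarrow> real \<Rightarrow> real" where
  "edge_scaling l n x =
     real n powr (2/3) * (x - d_plus l) / (sqrt l * (1 + sqrt l) powr (4/3))"

end

theory Submission
  imports Defs "HOL-Real_Asymp.Real_Asymp"
begin

text \<open>
  Write \<open>x\<close> for a vector indexed by the sites \<open>0, \<dots>, n + 1\<close> and vanishing at both ends. Since
  \<open>m M\<^bsub>n,m\<^esub> = B B\<^sup>T\<close>, its quadratic form is the sum over edges
  \<open>\<Sum>\<^sub>j (a\<^sub>j x\<^sub>j + b\<^sub>j x\<^sub>j\<^sub>+\<^sub>1)\<^sup>2\<close>. Put \<open>\<theta> = (n / m)\<^sup>1\<^sup>/\<^sup>2\<close>. The mixed term obeys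
  \<open>2 a b \<le> \<theta> a\<^sup>2 + b\<^sup>2 / \<theta>\<close>, with a second order defect, so up to a small error the form is linear in
  the squares \<open>a\<^sub>j\<^sup>2\<close> and \<open>b\<^sub>j\<^sup>2\<close>. With the squares replaced by their means it equals exactly
  \<open>\<Sum>\<^sub>i (\<Lambda> - \<kappa> (n - i) - \<kappa> / 2) x\<^sub>i\<^sup>2\<close> minus a discrete Dirichlet energy whose weights are of
  order \<open>n\<close> near the bottom right corner, where
  \<open>\<Lambda> = (m\<^sup>1\<^sup>/\<^sup>2 + n\<^sup>1\<^sup>/\<^sup>2)\<^sup>2\<close> and \<open>\<kappa> = 2 + \<theta> + 1 / \<theta>\<close>. It is a Schroedinger operator
  with a linear potential growing away from the bottom right corner (the discrete Airy operator), plus noise.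

  The whole argument is deterministic on one event of probability \<open>1 - o(1)\<close>: every window of at most
  \<open>\<lceil>n\<^sup>1\<^sup>/\<^sup>3\<rceil>\<close> consecutive centred squares sums to at most \<open>s = 3 n\<^sup>2\<^sup>/\<^sup>3 log n\<close> in absolute value
  (Chernoff bound and union bound, \<open>LOE_noise_windows\<close>). Summation by parts over windows
  (\<open>summation_by_parts_windows\<close>) then bounds the noise by a multiple of \<open>n\<^sup>1\<^sup>/\<^sup>3 log n\<close> times the mass
  plus a total variation term, and the latter is absorbed by the Dirichlet energy at a cost
  \<open>O(s\<^sup>2 / n) = O(n\<^sup>1\<^sup>/\<^sup>3 (log n)\<^sup>2)\<close>. Two consequences follow. A tent function on the last
  \<open>2 n\<^sup>1\<^sup>/\<^sup>3\<close> sites shows that the top eigenvalue of \<open>B B\<^sup>T\<close> is at least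
  \<open>\<Lambda> - O(n\<^sup>1\<^sup>/\<^sup>3 (log n)\<^sup>2)\<close> (\<open>edge_form_tent\<close>). Vectors supported at distance at least
  \<open>K = n\<^sup>1\<^sup>/\<^sup>3 (log n)\<^sup>3\<close> from the corner have Rayleigh quotient at most
  \<open>\<Lambda> - \<kappa> K / 2 + O(n\<^sup>1\<^sup>/\<^sup>3 (log n)\<^sup>2)\<close> (\<open>edge_form_upper\<close>).

  The resulting gap of order \<open>K\<close> forces the top eigenvector to decay: an Agmon estimate with the weight
  \<open>exp (n\<^sup>-\<^sup>1\<^sup>/\<^sup>3 (n - i - K)) - 1\<close> (\<open>eigenvector_decay\<close>) bounds its mass beyond distance \<open>p > 2 K\<close>
  by about \<open>exp (- 2 (log n)\<^sup>3)\<close>, smaller than any power of \<open>n\<close>. Truncating the eigenvector to the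
  last \<open>p\<close> sites changes the form only through the one edge that is cut (\<open>truncated_eigenvector\<close>), so the minor has
  almost the same largest eigenvalue; it is never larger, as vectors of the minor extend by zero. The rescaled
  statement is the same event multiplied by a deterministic factor.
\<close>

unbundle no inner_syntax
unbundle no vec_syntax

section \<open>The largest eigenvalue of a symmetric matrix\<close>

text \<open>The sphere is compact. The dimension is a number and not a type, so vectors are functions on \<open>nat\<close> that
  vanish from \<open>n\<close> on, and the cube containing the sphere is compact as a product of compact factors.\<close>

lemma quadratic_form_attains_max:
  fixes A :: "nat \<Rightarrow> nat \<Rightarrow> real"
  assumes "n > 0"
  obtains x where "(\<Sum>i<n. (x i)\<^sup>2) = 1"
    "\<And>y. (\<Sum>i<n. (y i)\<^sup>2) = 1 \<Longrightarrow>
       (\<Sum>i<n. \<Sum>j<n. A i j * y i * y j) \<le> (\<Sum>i<n. \<Sum>j<n. A i j * x i * x j)"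
proof -
  define K where "K = (PiE UNIV (\<lambda>i. if i < n then {-1..1::real} else {0}))"
  define S where "S = {x :: nat \<Rightarrow> real. (\<Sum>i<n. (x i)\<^sup>2) = 1}"
  define q where "q = (\<lambda>x :: nat \<Rightarrow> real. \<Sum>i<n. \<Sum>j<n. A i j * x i * x j)"
  have cq: "continuous_on UNIV q"
    unfolding q_def by (intro continuous_intros continuous_on_product_coordinates)
  have cS: "continuous_on UNIV (\<lambda>x :: nat \<Rightarrow> real. \<Sum>i<n. (x i)\<^sup>2)"
    by (intro continuous_intros continuous_on_product_coordinates)
  have "compactin (product_topology (\<lambda>i::nat. euclidean :: real topology) UNIV) K"
    unfolding K_def compactin_PiE by auto
  then have "compact K"
    by (simp add: euclidean_product_topology)
  moreover have "closed S"
  proof -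
    have "closed ((\<lambda>x :: nat \<Rightarrow> real. \<Sum>i<n. (x i)\<^sup>2) -` {1})"
      by (rule continuous_closed_vimage) (use cS in \<open>auto simp: continuous_on_eq_continuous_at\<close>)
    then show ?thesis by (simp add: S_def vimage_def)
  qed
  ultimately have cKS: "compact (K \<inter> S)" by (rule compact_Int_closed)
  have "(\<lambda>i. if i = 0 then 1 else 0) \<in> K \<inter> S"
    using assms by (auto simp: K_def S_def power2_eq_square if_distrib cong: if_cong)
  then have "K \<inter> S \<noteq> {}" by blast
  from continuous_attains_sup[OF cKS this] obtain x where x: "x \<in> K \<inter> S" "\<forall>y\<in>K \<inter> S. q y \<le> q x"
    using cq continuous_on_subset by blast
  show ?thesis
  proof
    show "(\<Sum>i<n. (x i)\<^sup>2) = 1" using x by (auto simp: S_def)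
    fix y :: "nat \<Rightarrow> real" assume y: "(\<Sum>i<n. (y i)\<^sup>2) = 1"
    define z where "z = (\<lambda>i. if i < n then y i else 0)"
    have "\<bar>y i\<bar> \<le> 1" if "i < n" for i
    proof -
      have "(y i)\<^sup>2 \<le> (\<Sum>i<n. (y i)\<^sup>2)" using that by (intro member_le_sum) auto
      then show ?thesis using y by (simp add: abs_square_le_1)
    qed
    then have "z \<in> K" by (auto simp: K_def z_def abs_le_iff minus_le_iff)
    moreover have "z \<in> S" using y by (simp add: S_def z_def)
    ultimately have "q z \<le> q x" using x by blast
    moreover have "q z = q y" by (simp add: q_def z_def)
    ultimately show "(\<Sum>i<n. \<Sum>j<n. A i j * y i * y j) \<le> (\<Sum>i<n. \<Sum>j<n. A i j * x i * x j)"
      by (simp add: q_def)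
  qed
qed

text \<open>First order optimality without derivatives: for small \<open>t\<close> of the sign of \<open>c\<close> the linear term would win.\<close>

lemma linear_coefficient_zero:
  fixes c d :: real
  assumes "\<And>t. 2 * t * c \<le> t\<^sup>2 * d"
  shows "c = 0"
proof (rule ccontr)
  assume c: "c \<noteq> 0"
  define t where "t = c / (\<bar>d\<bar> + 1)"
  have "2 * t * c \<le> t\<^sup>2 * d" by (rule assms)
  also have "\<dots> \<le> t\<^sup>2 * (\<bar>d\<bar> + 1)" by (intro mult_left_mono) auto
  also have "\<dots> = t * c" by (simp add: t_def power2_eq_square)
  finally have "t * c \<le> 0" by (simp add: mult.commute)
  moreover have "t * c > 0" using c by (simp add: t_def power2_eq_square[symmetric])
  ultimately show False by simp
qed

lemma scalar_prod_quadratic: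
  fixes A :: "real mat"
  assumes "A \<in> carrier_mat n n" "u \<in> carrier_vec n" "v \<in> carrier_vec n"
  shows "u \<bullet> (A *\<^sub>v v) = (\<Sum>i<n. \<Sum>j<n. A $$ (i,j) * u $ i * v $ j)"
  using assms by (auto simp: scalar_prod_def lessThan_atLeast0 sum_distrib_left intro!: sum.cong)

text \<open>Rayleigh's principle. A maximizer of the quadratic form on the sphere is an eigenvector, because perturbing it in any
  direction \<open>h\<close> gives a quadratic inequality in \<open>t\<close> whose linear coefficient must vanish.\<close>

lemma largest_eigenvalue_variational:
  fixes A :: "real mat"
  assumes A: "A \<in> carrier_mat n n" and sym: "A\<^sup>T = A" and n: "n > 0"
  shows "\<exists>v\<in>carrier_vec n. v \<bullet> v = 1 \<and> A *\<^sub>v v = largest_eigenvalue A \<cdot>\<^sub>v v"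
    and "\<And>u. u \<in> carrier_vec n \<Longrightarrow> u \<bullet> (A *\<^sub>v u) \<le> largest_eigenvalue A * (u \<bullet> u)"
proof -
  obtain x where x: "(\<Sum>i<n. (x i)\<^sup>2) = 1"
    and max: "\<And>y. (\<Sum>i<n. (y i)\<^sup>2) = 1 \<Longrightarrow>
       (\<Sum>i<n. \<Sum>j<n. A $$ (i,j) * y i * y j) \<le> (\<Sum>i<n. \<Sum>j<n. A $$ (i,j) * x i * x j)"
    using quadratic_form_attains_max[OF n, of "\<lambda>i j. A $$ (i,j)"] by blast
  define v where "v = vec n x"
  define R where "R = v \<bullet> (A *\<^sub>v v)"
  have v[simp]: "v \<in> carrier_vec n" by (simp add: v_def)
  have vv: "v \<bullet> v = 1"
    using x by (simp add: v_def scalar_prod_def lessThan_atLeast0 power2_eq_square)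
  have ray: "u \<bullet> (A *\<^sub>v u) \<le> R * (u \<bullet> u)" if u: "u \<in> carrier_vec n" for u
  proof (cases "u \<bullet> u = 0")
    case True
    then have "(\<Sum>i<n. (u $ i)\<^sup>2) = 0"
      using u by (simp add: scalar_prod_def lessThan_atLeast0 power2_eq_square)
    then have "\<And>i. i < n \<Longrightarrow> u $ i = 0" by (subst (asm) sum_nonneg_eq_0_iff) auto
    then have "u \<bullet> (A *\<^sub>v u) = 0" by (subst scalar_prod_quadratic[OF A u u]) auto
    then show ?thesis using True by simp
  next
    case False
    have uu: "u \<bullet> u = (\<Sum>i<n. (u $ i)\<^sup>2)"
      using u by (simp add: scalar_prod_def lessThan_atLeast0 power2_eq_square)
    then have pos: "u \<bullet> u > 0" using False by (metis less_eq_real_def sum_nonneg zero_le_power2)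
    define r where "r = sqrt (u \<bullet> u)"
    have r: "r > 0" "r\<^sup>2 = u \<bullet> u" using pos by (auto simp: r_def)
    have "(\<Sum>i<n. (u $ i / r)\<^sup>2) = 1"
      using r uu pos by (simp add: power_divide flip: sum_divide_distrib)
    from max[OF this] have "(\<Sum>i<n. \<Sum>j<n. A $$ (i,j) * (u $ i / r) * (u $ j / r)) \<le> R"
      by (simp add: R_def scalar_prod_quadratic[OF A v v]) (simp add: v_def)
    moreover have "(\<Sum>i<n. \<Sum>j<n. A $$ (i,j) * (u $ i / r) * (u $ j / r)) = (u \<bullet> (A *\<^sub>v u)) / r\<^sup>2"
      by (simp add: scalar_prod_quadratic[OF A u u] power2_eq_square sum_divide_distrib)
    ultimately show ?thesis using r pos by (simp only:) (simp add: pos_divide_le_eq)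
  qed
  have symm: "u \<bullet> (A *\<^sub>v w) = w \<bullet> (A *\<^sub>v u)" if "u \<in> carrier_vec n" "w \<in> carrier_vec n" for u w
  proof -
    have "u \<bullet> (A *\<^sub>v w) = (A\<^sup>T *\<^sub>v u) \<bullet> w" using transpose_vec_mult_scalar[OF A that(2,1)] by simp
    then show ?thesis using that A by (simp add: sym comm_scalar_prod[of _ n])
  qed
  have ort: "h \<bullet> (A *\<^sub>v v - R \<cdot>\<^sub>v v) = 0" if h: "h \<in> carrier_vec n" for h
  proof (rule linear_coefficient_zero)
    fix t :: real
    define u where "u = v + t \<cdot>\<^sub>v h"
    have u: "u \<in> carrier_vec n" using h by (simp add: u_def)
    have Av: "A *\<^sub>v v \<in> carrier_vec n" "A *\<^sub>v h \<in> carrier_vec n" using A h by auto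
    have Au: "A *\<^sub>v u = A *\<^sub>v v + t \<cdot>\<^sub>v (A *\<^sub>v h)"
      using A h by (simp add: u_def mult_add_distrib_mat_vec[of _ n n] mult_mat_vec[of _ n n])
    have 1: "u \<bullet> (A *\<^sub>v u) = R + 2 * t * (h \<bullet> (A *\<^sub>v v)) + t\<^sup>2 * (h \<bullet> (A *\<^sub>v h))"
      unfolding Au using h A Av symm[OF v h]
      by (simp add: u_def add_scalar_prod_distrib[of _ n] scalar_prod_add_distrib[of _ n] R_def
            power2_eq_square algebra_simps)
    have 2: "u \<bullet> u = 1 + 2 * t * (h \<bullet> v) + t\<^sup>2 * (h \<bullet> h)"
      using h comm_scalar_prod[OF v h]
      by (simp add: u_def add_scalar_prod_distrib[of _ n] scalar_prod_add_distrib[of _ n] vv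
            power2_eq_square algebra_simps)
    have 3: "h \<bullet> (A *\<^sub>v v - R \<cdot>\<^sub>v v) = h \<bullet> (A *\<^sub>v v) - R * (h \<bullet> v)"
      using h A Av by (simp add: scalar_prod_minus_distrib[of _ n])
    show "2 * t * (h \<bullet> (A *\<^sub>v v - R \<cdot>\<^sub>v v)) \<le> t\<^sup>2 * (R * (h \<bullet> h) - h \<bullet> (A *\<^sub>v h))"
      using ray[OF u] unfolding 1 2 3 by (simp add: algebra_simps)
  qed
  have Avc: "A *\<^sub>v v \<in> carrier_vec n" using A by auto
  have eig: "A *\<^sub>v v = R \<cdot>\<^sub>v v"
  proof (rule eq_vecI)
    fix i assume i: "i < dim_vec (R \<cdot>\<^sub>v v)"
    then have i: "i < n" by (simp add: v_def)
    have "unit_vec n i \<bullet> (A *\<^sub>v v - R \<cdot>\<^sub>v v) = (A *\<^sub>v v - R \<cdot>\<^sub>v v) $ i"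
      using i Avc by (intro scalar_prod_left_unit) auto
    with ort[of "unit_vec n i"] have "(A *\<^sub>v v - R \<cdot>\<^sub>v v) $ i = 0" by simp
    then show "(A *\<^sub>v v) $ i = (R \<cdot>\<^sub>v v) $ i" using i Avc A by (auto simp: v_def)
  qed (use A in \<open>auto simp: v_def\<close>)
  have v0: "v \<noteq> 0\<^sub>v n" using vv by auto
  have ev: "eigenvalue A R" unfolding eigenvalue_def eigenvector_def
    by (rule exI[of _ v]) (use eig v0 A v in auto)
  have le: "e \<le> R" if "eigenvalue A e" for e
  proof -
    from that obtain u where u: "u \<in> carrier_vec n" "u \<noteq> 0\<^sub>v n" "A *\<^sub>v u = e \<cdot>\<^sub>v u"
      using A unfolding eigenvalue_def eigenvector_def by auto
    have uu: "u \<bullet> u = (\<Sum>i<n. (u $ i)\<^sup>2)"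
      using u by (simp add: scalar_prod_def lessThan_atLeast0 power2_eq_square)
    have "u \<bullet> u \<noteq> 0"
    proof
      assume "u \<bullet> u = 0"
      then have "\<And>i. i < n \<Longrightarrow> u $ i = 0" unfolding uu by (subst (asm) sum_nonneg_eq_0_iff) auto
      then have "u = 0\<^sub>v n" using u by (intro eq_vecI) auto
      then show False using u by simp
    qed
    then have pos: "u \<bullet> u > 0" using uu by (metis less_eq_real_def sum_nonneg zero_le_power2)
    have "e * (u \<bullet> u) \<le> R * (u \<bullet> u)" using ray[OF u(1)] u by simp
    then show ?thesis using pos by simp
  qed
  have "finite {e. eigenvalue A e}"
  proof -
    have "char_poly A \<noteq> 0" using degree_monic_char_poly[OF A] by auto
    then show ?thesis unfolding eigenvalue_root_char_poly[OF A] by (rule poly_roots_finite)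
  qed
  then have R: "largest_eigenvalue A = R"
    unfolding largest_eigenvalue_def using ev le by (intro Max_eqI) auto
  show "\<exists>v\<in>carrier_vec n. v \<bullet> v = 1 \<and> A *\<^sub>v v = largest_eigenvalue A \<cdot>\<^sub>v v"
    using vv eig v unfolding R by blast
  show "\<And>u. u \<in> carrier_vec n \<Longrightarrow> u \<bullet> (A *\<^sub>v u) \<le> largest_eigenvalue A * (u \<bullet> u)"
    using ray unfolding R .
qed

text \<open>Rational test vectors suffice by density, which makes the condition a countable intersection and hence gives
  measurability of the largest eigenvalue.\<close>

lemma largest_eigenvalue_le_iff:
  fixes A :: "real mat"
  assumes A: "A \<in> carrier_mat n n" and sym: "A\<^sup>T = A" and n: "n > 0"
  shows "largest_eigenvalue A \<le> c \<longleftrightarrow>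
    (\<forall>y \<in> PiE {..<n} (\<lambda>_. \<rat>). (\<Sum>i<n. \<Sum>j<n. A $$ (i,j) * y i * y j) \<le> c * (\<Sum>i<n. (y i)\<^sup>2))"
    (is "_ \<longleftrightarrow> ?R")
proof
  assume le: "largest_eigenvalue A \<le> c"
  show ?R
  proof
    fix y :: "nat \<Rightarrow> real"
    have "vec n y \<bullet> (A *\<^sub>v vec n y) \<le> largest_eigenvalue A * (vec n y \<bullet> vec n y)"
      by (rule largest_eigenvalue_variational(2)[OF A sym n]) simp
    also have "vec n y \<bullet> vec n y = (\<Sum>i<n. (y i)\<^sup>2)"
      by (simp add: scalar_prod_def lessThan_atLeast0 power2_eq_square)
    also have "largest_eigenvalue A * (\<Sum>i<n. (y i)\<^sup>2) \<le> c * (\<Sum>i<n. (y i)\<^sup>2)"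
      using le by (intro mult_right_mono sum_nonneg) auto
    also have "vec n y \<bullet> (A *\<^sub>v vec n y) = (\<Sum>i<n. \<Sum>j<n. A $$ (i,j) * y i * y j)"
      by (simp add: scalar_prod_quadratic[OF A])
    finally show "(\<Sum>i<n. \<Sum>j<n. A $$ (i,j) * y i * y j) \<le> c * (\<Sum>i<n. (y i)\<^sup>2)" .
  qed
next
  assume R: ?R
  obtain v where v: "v \<in> carrier_vec n" "v \<bullet> v = 1" "A *\<^sub>v v = largest_eigenvalue A \<cdot>\<^sub>v v"
    using largest_eigenvalue_variational(1)[OF A sym n] by blast
  have "\<exists>r\<in>\<rat>. v $ i < r \<and> r < v $ i + 1 / real (Suc k)" for i k
    by (rule Rats_dense_in_real) simp
  then obtain r where r: "\<And>i k. r i k \<in> \<rat>" "\<And>i k. v $ i < r i k" "\<And>i k. r i k < v $ i + 1 / real (Suc k)"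
    by metis
  have lim: "(\<lambda>k. r i k) \<longlonglongrightarrow> v $ i" for i
  proof (rule tendsto_sandwich[OF _ _ tendsto_const])
    have "(\<lambda>k. v $ i + 1 / real (Suc k)) \<longlonglongrightarrow> v $ i + 0"
      by (intro tendsto_intros LIMSEQ_Suc[OF lim_1_over_n])
    then show "(\<lambda>k. v $ i + 1 / real (Suc k)) \<longlonglongrightarrow> v $ i" by simp
  qed (use r(2,3) in \<open>auto simp: less_imp_le simp del: of_nat_Suc intro!: always_eventually\<close>)
  have "(\<Sum>i<n. \<Sum>j<n. A $$ (i,j) * v $ i * v $ j) \<le> c * (\<Sum>i<n. (v $ i)\<^sup>2)"
  proof (rule LIMSEQ_le)
    show "(\<lambda>k. \<Sum>i<n. \<Sum>j<n. A $$ (i,j) * r i k * r j k) \<longlonglongrightarrow> (\<Sum>i<n. \<Sum>j<n. A $$ (i,j) * v $ i * v $ j)"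
      by (intro tendsto_intros lim)
    show "(\<lambda>k. c * (\<Sum>i<n. (r i k)\<^sup>2)) \<longlonglongrightarrow> c * (\<Sum>i<n. (v $ i)\<^sup>2)"
      by (intro tendsto_intros lim)
    show "\<exists>N. \<forall>k\<ge>N. (\<Sum>i<n. \<Sum>j<n. A $$ (i,j) * r i k * r j k) \<le> c * (\<Sum>i<n. (r i k)\<^sup>2)"
    proof (intro exI allI impI)
      fix k
      show "(\<Sum>i<n. \<Sum>j<n. A $$ (i,j) * r i k * r j k) \<le> c * (\<Sum>i<n. (r i k)\<^sup>2)"
        using R[rule_format, of "restrict (\<lambda>i. r i k) {..<n}"] r(1) by simp
    qed
  qed
  also have "(\<Sum>i<n. (v $ i)\<^sup>2) = 1"
    using v by (simp add: scalar_prod_def lessThan_atLeast0 power2_eq_square)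
  also have "(\<Sum>i<n. \<Sum>j<n. A $$ (i,j) * v $ i * v $ j) = v \<bullet> (A *\<^sub>v v)"
    by (rule scalar_prod_quadratic[OF A v(1) v(1), symmetric])
  also have "\<dots> = largest_eigenvalue A" unfolding v(3) using v(1,2) by simp
  finally show "largest_eigenvalue A \<le> c" by simp
qed

lemma borel_measurable_largest_eigenvalue:
  fixes A :: "'w \<Rightarrow> real mat"
  assumes A: "\<And>w. A w \<in> carrier_mat n n" and sym: "\<And>w. (A w)\<^sup>T = A w" and n: "n > 0"
    and meas: "\<And>i j. i < n \<Longrightarrow> j < n \<Longrightarrow> (\<lambda>w. A w $$ (i,j)) \<in> borel_measurable M"
  shows "(\<lambda>w. largest_eigenvalue (A w)) \<in> borel_measurable M"
proof (rule borel_measurableI_le)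
  fix c
  have "countable (PiE {..<n} (\<lambda>_. \<rat> :: real set))"
    by (rule countable_PiE) (auto simp: countable_rat)
  then have "{w \<in> space M. \<forall>y \<in> PiE {..<n} (\<lambda>_. \<rat>).
      (\<Sum>i<n. \<Sum>j<n. A w $$ (i,j) * y i * y j) \<le> c * (\<Sum>i<n. (y i)\<^sup>2)} \<in> sets M"
    by (intro sets.sets_Collect_countable_All') (use meas in \<open>measurable; simp\<close>)
  then show "{w \<in> space M. largest_eigenvalue (A w) \<le> c} \<in> sets M"
    by (simp add: largest_eigenvalue_le_iff[OF A sym n])
qed

section \<open>Concentration of sums of chi-square variables\<close>

text \<open>The substitution \<open>u = (1 / 2 - t) x\<close> turns the exponentially tilted density into the Gamma integrand.\<close>

lemma chi_square_mgf:
  assumes X: "distributed M lborel X (\<lambda>x. ennreal (chi_square_density k x))"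
    and k: "k > 0" and t: "t < 1 / 2"
  shows "(\<integral>\<^sup>+w. ennreal (exp (t * X w)) \<partial>M) = ennreal ((1 - 2 * t) powr (- (real k / 2)))"
proof -
  define s where "s = real k / 2"
  define c where "c = 1 / 2 - t"
  define K where "K = 1 / (2 powr s * Gamma s * c powr (s - 1))"
  define g where "g = (\<lambda>u::real. indicator {0..} u * u powr (s - 1) / exp u)"
  have s: "s > 0" and c: "c > 0" using k t by (auto simp: s_def c_def)
  have G: "Gamma s > 0" using s by (rule Gamma_real_pos)
  have K: "K \<ge> 0" using G by (simp add: K_def)
  have g0: "g u \<ge> 0" for u by (simp add: g_def)
  have gm[measurable]: "g \<in> borel_measurable borel" unfolding g_def by measurable
  have pt: "chi_square_density k x * exp (t * x) = K * g (c * x)" for x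
  proof (cases "x > 0")
    case True
    have "exp (- x / 2) * exp (t * x) = exp (- (c * x))"
      by (simp add: c_def algebra_simps flip: exp_add)
    moreover have "(c * x) powr (s - 1) = c powr (s - 1) * x powr (s - 1)"
      using True c by (simp add: powr_mult)
    ultimately show ?thesis
      using True c G
      by (simp add: chi_square_density_def K_def g_def exp_minus field_simps flip: s_def)
  next
    case False
    then show ?thesis using c
      by (auto simp: chi_square_density_def g_def indicator_def zero_le_mult_iff)
  qed
  have "ennreal (Gamma s) = (\<integral>\<^sup>+u. ennreal (g u) \<partial>lborel)"
    using Gamma_conv_nn_integral_real[OF s] by (simp add: g_def)
  also have "\<dots> = ennreal \<bar>c\<bar> * (\<integral>\<^sup>+x. ennreal (g (0 + c * x)) \<partial>lborel)"
    by (rule nn_integral_real_affine) (use c in auto)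
  finally have 1: "ennreal (Gamma s) = ennreal c * (\<integral>\<^sup>+x. ennreal (g (c * x)) \<partial>lborel)"
    using c by simp
  have "(\<integral>\<^sup>+w. ennreal (exp (t * X w)) \<partial>M)
      = (\<integral>\<^sup>+x. ennreal (chi_square_density k x) * ennreal (exp (t * x)) \<partial>lborel)"
    by (rule distributed_nn_integral[OF X, symmetric]) simp
  also have "\<dots> = (\<integral>\<^sup>+x. ennreal K * ennreal (g (c * x)) \<partial>lborel)"
    by (intro nn_integral_cong) (simp add: pt K g0 flip: ennreal_mult'')
  also have "\<dots> = ennreal K * (\<integral>\<^sup>+x. ennreal (g (c * x)) \<partial>lborel)"
    by (rule nn_integral_cmult) simp
  also have "\<dots> = ennreal (K / c) * (ennreal c * (\<integral>\<^sup>+x. ennreal (g (c * x)) \<partial>lborel))"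
    using c K by (simp add: mult.assoc[symmetric] flip: ennreal_mult'')
  also have "\<dots> = ennreal (K / c * Gamma s)"
    unfolding 1[symmetric] using G by (simp flip: ennreal_mult'')
  also have "K / c * Gamma s = (1 - 2 * t) powr (- s)"
  proof -
    have "1 - 2 * t = 2 * c" by (simp add: c_def)
    moreover have "c powr (s - 1) * c = c powr s"
      using c by (simp add: powr_diff)
    moreover have "K / c * Gamma s = 1 / (2 powr s * (c powr (s - 1) * c))"
      using c G by (simp add: K_def field_simps)
    ultimately show ?thesis using c
      by (simp add: powr_minus powr_mult divide_inverse)
  qed
  finally show ?thesis by (simp add: s_def)
qed

text \<open>The centred moment generating function is subgaussian near \<open>0\<close>, since \<open>- ln (1 - 2 t) \<le> 2 t + 8 t\<^sup>2\<close>.\<close>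

lemma one_minus_powr_le_exp:
  fixes t d :: real
  assumes t: "\<bar>t\<bar> \<le> 1 / 4" and d: "d \<ge> 0"
  shows "exp (- t * d) * (1 - 2 * t) powr (- (d / 2)) \<le> exp (4 * t\<^sup>2 * d)"
proof -
  have "\<bar>ln (1 + (- 2 * t)) - (- 2 * t)\<bar> \<le> 2 * (- 2 * t)\<^sup>2"
    by (rule abs_ln_one_plus_x_minus_x_bound) (use t in auto)
  then have "- ln (1 - 2 * t) \<le> 2 * t + 8 * t\<^sup>2" by (simp add: power2_eq_square abs_le_iff)
  then have "d / 2 * (- ln (1 - 2 * t)) \<le> d / 2 * (2 * t + 8 * t\<^sup>2)"
    using d by (intro mult_left_mono) auto
  then show ?thesis using t
    by (simp add: powr_def algebra_simps flip: exp_add)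
qed

context prob_space begin

lemma chi_square_sum_mgf:
  fixes X :: "'i \<Rightarrow> 'a \<Rightarrow> real" and k :: "'i \<Rightarrow> nat"
  assumes I: "finite I" and ind: "indep_vars (\<lambda>_. borel) X I"
    and X: "\<And>i. i \<in> I \<Longrightarrow> distributed M lborel (X i) (\<lambda>x. ennreal (chi_square_density (k i) x))"
    and k: "\<And>i. i \<in> I \<Longrightarrow> k i > 0" and t: "\<bar>t\<bar> \<le> 1 / 4"
  shows "(\<integral>\<^sup>+w. ennreal (exp (t * (\<Sum>i\<in>I. X i w - real (k i)))) \<partial>M)
         \<le> ennreal (exp (4 * t\<^sup>2 * (\<Sum>i\<in>I. real (k i))))"
proof -
  have rv[measurable]: "random_variable borel (X i)" if "i \<in> I" for i
    using ind that by (auto simp: indep_vars_def)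
  have "(\<integral>\<^sup>+w. ennreal (exp (t * (\<Sum>i\<in>I. X i w - real (k i)))) \<partial>M)
      = (\<integral>\<^sup>+w. (\<Prod>i\<in>I. ennreal (exp (t * (X i w - real (k i))))) \<partial>M)"
    using I by (simp add: sum_distrib_left exp_sum prod_ennreal)
  also have "\<dots> = (\<Prod>i\<in>I. \<integral>\<^sup>+w. ennreal (exp (t * (X i w - real (k i)))) \<partial>M)"
    by (intro indep_vars_nn_integral I indep_vars_compose2[OF ind]) auto
  also have "\<dots> \<le> (\<Prod>i\<in>I. ennreal (exp (4 * t\<^sup>2 * real (k i))))"
  proof (intro prod_mono_ennreal)
    fix i assume i: "i \<in> I"
    have "(\<integral>\<^sup>+w. ennreal (exp (t * (X i w - real (k i)))) \<partial>M)
        = (\<integral>\<^sup>+w. ennreal (exp (- t * real (k i))) * ennreal (exp (t * X i w)) \<partial>M)"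
      by (intro nn_integral_cong) (simp add: algebra_simps flip: ennreal_mult'' exp_add)
    also have "\<dots> = ennreal (exp (- t * real (k i))) * (\<integral>\<^sup>+w. ennreal (exp (t * X i w)) \<partial>M)"
      by (rule nn_integral_cmult) (use i in measurable)
    also have "\<dots> = ennreal (exp (- t * real (k i)) * (1 - 2 * t) powr (- (real (k i) / 2)))"
      using t by (subst chi_square_mgf[OF X[OF i] k[OF i]]) (auto simp flip: ennreal_mult'')
    also have "\<dots> \<le> ennreal (exp (4 * t\<^sup>2 * real (k i)))"
      by (intro ennreal_leI one_minus_powr_le_exp t) simp
    finally show "(\<integral>\<^sup>+w. ennreal (exp (t * (X i w - real (k i)))) \<partial>M) \<le> ennreal (exp (4 * t\<^sup>2 * real (k i)))" .
  qed
  also have "\<dots> = ennreal (exp (4 * t\<^sup>2 * (\<Sum>i\<in>I. real (k i))))"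
    using I by (simp add: sum_distrib_left exp_sum prod_ennreal)
  finally show ?thesis .
qed

text \<open>Chernoff's bound for both tails. The parameter \<open>t\<close> is left free; it is later tied to the window length.\<close>

lemma chi_square_sum_tail:
  fixes X :: "'i \<Rightarrow> 'a \<Rightarrow> real" and k :: "'i \<Rightarrow> nat"
  assumes I: "finite I" and ind: "indep_vars (\<lambda>_. borel) X I"
    and X: "\<And>i. i \<in> I \<Longrightarrow> distributed M lborel (X i) (\<lambda>x. ennreal (chi_square_density (k i) x))"
    and k: "\<And>i. i \<in> I \<Longrightarrow> k i > 0" and t: "0 \<le> t" "t \<le> 1 / 4"
  shows "prob {w \<in> space M. \<not> \<bar>\<Sum>i\<in>I. X i w - real (k i)\<bar> \<le> s}
         \<le> 2 * exp (- t * s + 4 * t\<^sup>2 * (\<Sum>i\<in>I. real (k i)))"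
proof -
  define S where "S = (\<lambda>w. \<Sum>i\<in>I. X i w - real (k i))"
  define U where "U = (\<Sum>i\<in>I. real (k i))"
  have rv[measurable]: "random_variable borel (X i)" if "i \<in> I" for i
    using ind that by (auto simp: indep_vars_def)
  have [measurable]: "random_variable borel S" unfolding S_def by measurable
  have one: "prob {w \<in> space M. \<sigma> * S w \<ge> s} \<le> exp (- t * s + 4 * t\<^sup>2 * U)"
    if \<sigma>: "\<sigma> \<in> {1, -1}" for \<sigma> :: real
  proof -
    have "{w \<in> space M. \<sigma> * S w \<ge> s}
        \<subseteq> {w \<in> space M. 1 \<le> ennreal (exp (- t * s)) * ennreal (exp ((\<sigma> * t) * S w))}"
    proof safe
      fix w assume "s \<le> \<sigma> * S w"
      then have "t * s \<le> t * (\<sigma> * S w)" using t(1) by (rule mult_left_mono)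
      then have "1 \<le> exp (- t * s) * exp ((\<sigma> * t) * S w)"
        by (simp add: algebra_simps flip: exp_add)
      then show "1 \<le> ennreal (exp (- t * s)) * ennreal (exp ((\<sigma> * t) * S w))"
        by (simp flip: ennreal_mult'' ennreal_1)
    qed
    then have "emeasure M {w \<in> space M. \<sigma> * S w \<ge> s}
        \<le> emeasure M {w \<in> space M. 1 \<le> ennreal (exp (- t * s)) * ennreal (exp ((\<sigma> * t) * S w))}"
      by (intro emeasure_mono) measurable
    also have "\<dots> \<le> ennreal (exp (- t * s)) * (\<integral>\<^sup>+w. ennreal (exp ((\<sigma> * t) * S w)) * indicator (space M) w \<partial>M)"
      using nn_integral_Markov_inequality[of "\<lambda>w. ennreal (exp ((\<sigma> * t) * S w))" "space M" M "ennreal (exp (- t * s))"]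
      by simp
    also have "(\<integral>\<^sup>+w. ennreal (exp ((\<sigma> * t) * S w)) * indicator (space M) w \<partial>M) 
        = (\<integral>\<^sup>+w. ennreal (exp ((\<sigma> * t) * S w)) \<partial>M)"
      by (intro nn_integral_cong) simp
    also have "\<dots> \<le> ennreal (exp (4 * (\<sigma> * t)\<^sup>2 * U))"
      unfolding S_def U_def by (rule chi_square_sum_mgf[OF I ind X k]) (use t \<sigma> in auto)
    also have "(\<sigma> * t)\<^sup>2 = t\<^sup>2" using \<sigma> by auto
    finally have "emeasure M {w \<in> space M. \<sigma> * S w \<ge> s} \<le> ennreal (exp (- t * s + 4 * t\<^sup>2 * U))"
      unfolding exp_add ennreal_mult''[OF exp_ge_zero] by (simp add: mult_left_mono)
    then show ?thesis by (simp add: emeasure_eq_measure)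
  qed
  have "prob {w \<in> space M. \<not> \<bar>S w\<bar> \<le> s}
      \<le> prob ({w \<in> space M. 1 * S w \<ge> s} \<union> {w \<in> space M. (-1) * S w \<ge> s})"
    by (intro finite_measure_mono) auto
  also have "\<dots> \<le> prob {w \<in> space M. 1 * S w \<ge> s} + prob {w \<in> space M. (-1) * S w \<ge> s}"
    by (intro measure_Un_le) measurable
  also have "\<dots> \<le> exp (- t * s + 4 * t\<^sup>2 * U) + exp (- t * s + 4 * t\<^sup>2 * U)"
    by (intro add_mono one) auto
  finally show ?thesis by (simp add: S_def U_def)
qed

end

text \<open>Windows may stick out of \<open>{1..n}\<close>; they are then clipped. In this form the
  bound passes to the extension of the sequence by zeros, see \<open>window_bounded_extension\<close>.\<close>

definition window_bounded :: "nat \<Rightarrow> nat \<Rightarrow> real \<Rightarrow> (nat \<Rightarrow> real) \<Rightarrow> bool" where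
  "window_bounded n B s x \<longleftrightarrow> (\<forall>u\<le>n. \<forall>L\<le>B. \<bar>\<Sum>i\<in>{u..<u + L} \<inter> {1..n}. x i\<bar> \<le> s)"

lemma (in prob_space) chi_square_window_bounded:
  fixes X :: "nat \<Rightarrow> 'a \<Rightarrow> real" and k :: "nat \<Rightarrow> nat"
  assumes ind: "indep_vars (\<lambda>_. borel) X {1..N}"
    and X: "\<And>i. i \<in> {1..N} \<Longrightarrow> distributed M lborel (X i) (\<lambda>x. ennreal (chi_square_density (k i) x))"
    and k: "\<And>i. i \<in> {1..N} \<Longrightarrow> 0 < k i \<and> k i \<le> m" and t: "0 \<le> t" "t \<le> 1 / 4"
  shows "{w \<in> space M. \<not> window_bounded N B s (\<lambda>i. X i w - real (k i))} \<in> events"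
    and "prob {w \<in> space M. \<not> window_bounded N B s (\<lambda>i. X i w - real (k i))}
         \<le> (real N + 1) * (real B + 1) * (2 * exp (- t * s + 4 * t\<^sup>2 * (real m * real B)))"
proof -
  define J where "J = (\<lambda>(u, L). {u..<u + L} \<inter> {1..N})"
  define E where "E = (\<lambda>q. {w \<in> space M. \<not> \<bar>\<Sum>i\<in>J q. X i w - real (k i)\<bar> \<le> s})"
  have eq: "{w \<in> space M. \<not> window_bounded N B s (\<lambda>i. X i w - real (k i))} = (\<Union>q\<in>{..N} \<times> {..B}. E q)"
  proof (rule Set.set_eqI)
    fix w
    have "(\<not> window_bounded N B s (\<lambda>i. X i w - real (k i)))
        \<longleftrightarrow> (\<exists>q\<in>{..N} \<times> {..B}. \<not> \<bar>\<Sum>i\<in>J q. X i w - real (k i)\<bar> \<le> s)"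
      unfolding window_bounded_def J_def by (simp add: Bex_def)
    then show "w \<in> {w \<in> space M. \<not> window_bounded N B s (\<lambda>i. X i w - real (k i))}
        \<longleftrightarrow> w \<in> (\<Union>q\<in>{..N} \<times> {..B}. E q)"
      unfolding E_def by blast
  qed
  have rv[measurable]: "random_variable borel (X i)" if "i \<in> {1..N}" for i
    using ind that by (auto simp: indep_vars_def)
  have sub: "J q \<subseteq> {1..N}" for q by (auto simp: J_def split: prod.split)
  have Em: "E q \<in> events" for q
  proof -
    have "(\<lambda>w. \<Sum>i\<in>J q. X i w - real (k i)) \<in> borel_measurable M"
      by (intro borel_measurable_sum borel_measurable_diff borel_measurable_const rv) (use sub in blast)
    then show ?thesis unfolding E_def by measurable
  qed
  show "{w \<in> space M. \<not> window_bounded N B s (\<lambda>i. X i w - real (k i))} \<in> events"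
    unfolding eq by (intro sets.finite_UN Em) auto
  have "prob (\<Union>q\<in>{..N} \<times> {..B}. E q) \<le> (\<Sum>q\<in>{..N} \<times> {..B}. prob (E q))"
    by (intro finite_measure_subadditive_finite image_subsetI Em) auto
  also have "\<dots> \<le> (\<Sum>q\<in>{..N} \<times> {..B}. 2 * exp (- t * s + 4 * t\<^sup>2 * (real m * real B)))"
  proof (intro sum_mono)
    fix q assume q: "q \<in> {..N} \<times> {..B}"
    have fin: "finite (J q)" using sub finite_subset by blast
    have "prob (E q) \<le> 2 * exp (- t * s + 4 * t\<^sup>2 * (\<Sum>i\<in>J q. real (k i)))"
      unfolding E_def
    proof (rule chi_square_sum_tail[OF fin indep_vars_subset[OF ind sub] _ _ t])
      fix i assume "i \<in> J q"
      then have i: "i \<in> {1..N}" using sub by (rule subsetD[rotated])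
      show "distributed M lborel (X i) (\<lambda>x. ennreal (chi_square_density (k i) x))" by (rule X[OF i])
      show "0 < k i" using k[OF i] by simp
    qed
    also have "(\<Sum>i\<in>J q. real (k i)) \<le> real m * real B"
    proof -
      have "card (J q) \<le> B"
      proof -
        have "card (J q) \<le> card {fst q..<fst q + snd q}"
          by (rule card_mono) (auto simp: J_def split: prod.splits)
        then show ?thesis using q by (auto simp: mem_Times_iff)
      qed
      have "(\<Sum>i\<in>J q. real (k i)) \<le> real (card (J q)) * real m"
      proof (intro sum_bounded_above)
        fix i assume "i \<in> J q"
        then have "i \<in> {1..N}" using sub by blast
        then show "real (k i) \<le> real m" using k by simp
      qed
      also have "\<dots> \<le> real B * real m" using \<open>card (J q) \<le> B\<close> by (intro mult_right_mono) auto
      finally show ?thesis by (simp add: mult.commute)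
    qed
    then have "2 * exp (- t * s + 4 * t\<^sup>2 * (\<Sum>i\<in>J q. real (k i))) \<le> 2 * exp (- t * s + 4 * t\<^sup>2 * (real m * real B))"
      by (simp add: mult_left_mono)
    finally show "prob (E q) \<le> 2 * exp (- t * s + 4 * t\<^sup>2 * (real m * real B))" .
  qed
  also have "\<dots> = (real N + 1) * (real B + 1) * (2 * exp (- t * s + 4 * t\<^sup>2 * (real m * real B)))"
    by (simp add: card_cartesian_product algebra_simps)
  finally show "prob {w \<in> space M. \<not> window_bounded N B s (\<lambda>i. X i w - real (k i))}
      \<le> (real N + 1) * (real B + 1) * (2 * exp (- t * s + 4 * t\<^sup>2 * (real m * real B)))"
    unfolding eq .
qed

text \<open>Used to pass from the joint independence over the disjoint sum of index sets to the two sequences \<open>a\<close> and \<open>b\<close>.\<close>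

lemma (in prob_space) indep_vars_reindex_inj:
  assumes ind: "indep_vars M' X (f ` I)" and inj: "inj_on f I"
  shows "indep_vars (\<lambda>i. M' (f i)) (\<lambda>i. X (f i)) I"
proof -
  define F where "F = (\<lambda>i. {X i -` A \<inter> space M | A. A \<in> sets (M' i)})"
  have rv: "\<forall>i\<in>f ` I. random_variable (M' i) (X i)" and F: "indep_sets F (f ` I)"
    using ind unfolding indep_vars_def2 F_def by auto
  have "indep_sets (\<lambda>i. F (f i)) I"
  proof (rule indep_setsI)
    show "F (f i) \<subseteq> events" if "i \<in> I" for i
      using F that by (auto simp: indep_sets_def)
    fix A J assume J: "J \<noteq> {}" "J \<subseteq> I" "finite J" and A: "\<forall>j\<in>J. A j \<in> F (f j)"
    define g where "g = the_inv_into I f"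
    have g: "g (f j) = j" if "j \<in> J" for j
      using that J inj by (auto simp: g_def the_inv_into_f_f)
    have injJ: "inj_on f J" using inj J(2) by (rule inj_on_subset)
    have "prob (\<Inter>i\<in>f ` J. A (g i)) = (\<Prod>i\<in>f ` J. prob (A (g i)))"
      by (rule indep_setsD[OF F]) (use J A g in auto)
    then show "prob (\<Inter>j\<in>J. A j) = (\<Prod>j\<in>J. prob (A j))"
      using g by (simp add: prod.reindex[OF injJ])
  qed
  then show ?thesis using rv unfolding indep_vars_def2 F_def by auto
qed

lemma LOE_noise_windows:
  fixes s t :: real and B :: nat
  assumes E: "LOE_entries n m M a b" and nm: "n \<le> m" and n: "n \<ge> 1"
    and t: "0 \<le> t" "t \<le> 1 / 4"
  defines "bad \<equiv> {w \<in> space M. \<not> (window_bounded n B s (\<lambda>i. (a i w)\<^sup>2 - real (m - n + i)) \<and>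
                                window_bounded (n - 1) B s (\<lambda>i. (b i w)\<^sup>2 - real i))}"
  shows "bad \<in> sets M"
    and "measure M bad \<le> (real n + 1) * (real B + 1) * (4 * exp (- t * s + 4 * t\<^sup>2 * (real m * real B)))"
proof -
  interpret prob_space M using E by (simp add: LOE_entries_def)
  have ind: "indep_vars (\<lambda>_. borel) (case_sum a b) ({1..n} <+> {1..n - 1})"
    using E by (simp add: LOE_entries_def)
  have "indep_vars (\<lambda>_. borel) (\<lambda>i. case_sum a b (Inl i)) {1..n}"
    by (rule indep_vars_reindex_inj[where f = Inl]) (auto intro: indep_vars_subset[OF ind])
  then have ia: "indep_vars (\<lambda>_. borel) (\<lambda>i w. (a i w)\<^sup>2) {1..n}"
    by (intro indep_vars_compose2[where Y = "\<lambda>_ x. x\<^sup>2" and X = a]) auto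
  have "indep_vars (\<lambda>_. borel) (\<lambda>i. case_sum a b (Inr i)) {1..n - 1}"
    by (rule indep_vars_reindex_inj[where f = Inr]) (auto intro: indep_vars_subset[OF ind])
  then have ib: "indep_vars (\<lambda>_. borel) (\<lambda>i w. (b i w)\<^sup>2) {1..n - 1}"
    by (intro indep_vars_compose2[where Y = "\<lambda>_ x. x\<^sup>2" and X = b]) auto
  define bada where "bada = {w \<in> space M. \<not> window_bounded n B s (\<lambda>i. (a i w)\<^sup>2 - real (m - n + i))}"
  define badb where "badb = {w \<in> space M. \<not> window_bounded (n - 1) B s (\<lambda>i. (b i w)\<^sup>2 - real i)}"
  define X where "X = exp (- t * s + 4 * t\<^sup>2 * (real m * real B))"
  have da: "distributed M lborel (\<lambda>w. (a i w)\<^sup>2) (\<lambda>x. ennreal (chi_square_density (m - n + i) x))"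
    and ka: "0 < m - n + i \<and> m - n + i \<le> m" if "i \<in> {1..n}" for i
    using E nm that by (auto simp: LOE_entries_def)
  have db: "distributed M lborel (\<lambda>w. (b i w)\<^sup>2) (\<lambda>x. ennreal (chi_square_density i x))"
    and kb: "0 < i \<and> i \<le> m" if "i \<in> {1..n - 1}" for i
    using E nm that by (auto simp: LOE_entries_def)
  note wa = chi_square_window_bounded[OF ia da ka t, where B = B and s = s]
  note wb = chi_square_window_bounded[OF ib db kb t, where B = B and s = s]
  have a: "bada \<in> events" "prob bada \<le> (real n + 1) * (real B + 1) * (2 * X)"
    unfolding bada_def X_def by (rule wa; assumption)+
  have b: "badb \<in> events" "prob badb \<le> (real (n - 1) + 1) * (real B + 1) * (2 * X)"
    unfolding badb_def X_def by (rule wb; assumption)+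
  have eq: "bad = bada \<union> badb" by (auto simp: bad_def bada_def badb_def)
  show "bad \<in> sets M" using a b by (simp add: eq)
  have "prob bad \<le> prob bada + prob badb"
    unfolding eq using a b by (intro measure_Un_le)
  also have "\<dots> \<le> (real n + 1) * (real B + 1) * (2 * X) + (real (n - 1) + 1) * (real B + 1) * (2 * X)"
    by (intro add_mono a b)
  also have "\<dots> \<le> (real n + 1) * (real B + 1) * (2 * X) + (real n + 1) * (real B + 1) * (2 * X)"
    by (intro add_mono mult_right_mono order_refl) (auto simp: X_def)
  finally show "prob bad \<le> (real n + 1) * (real B + 1) * (4 * exp (- t * s + 4 * t\<^sup>2 * (real m * real B)))"
    by (simp add: X_def mult_ac)
qed

section \<open>The bidiagonal quadratic form and its noise\<close>

text \<open>A noise sequence is its moving average over windows of length \<open>B\<close>, which is at most \<open>s / B\<close>, minus the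
  discrete derivative of \<open>G\<close>, the mean over \<open>r < B\<close> of the partial sums starting at \<open>j\<close>, which is at
  most \<open>s\<close>. Summation by parts moves that derivative onto \<open>f\<close>.\<close>

lemma summation_by_parts_windows:
  fixes \<xi> f :: "nat \<Rightarrow> real"
  assumes B: "B \<ge> 1" and win: "\<And>u L. L \<le> B \<Longrightarrow> \<bar>\<Sum>i\<in>{u..<u + L}. \<xi> i\<bar> \<le> s"
    and f: "\<And>j. f j \<ge> 0" "f 0 = 0" "f (Suc n) = 0"
  shows "\<bar>\<Sum>j\<le>n. \<xi> j * f j\<bar> \<le> s / B * (\<Sum>j\<le>n. f j) + s * (\<Sum>j\<le>n. \<bar>f (Suc j) - f j\<bar>)"
proof -
  define W where "W = (\<lambda>j L. \<Sum>i\<in>{j..<j + L}. \<xi> i)"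
  define G where "G = (\<lambda>j. (\<Sum>r<B. W j r) / B)"
  have WB: "\<bar>W j L\<bar> \<le> s" if "L \<le> B" for j L using win[OF that] by (simp add: W_def)
  have GB: "\<bar>G j\<bar> \<le> s" for j
  proof -
    have "\<bar>\<Sum>r<B. W j r\<bar> \<le> (\<Sum>r<B. \<bar>W j r\<bar>)" by (rule sum_abs)
    also have "\<dots> \<le> (\<Sum>r<B. s)" by (intro sum_mono WB) auto
    finally show ?thesis using B by (simp add: G_def abs_divide pos_divide_le_eq mult.commute)
  qed
  have Wstep: "W (Suc j) r - W j r = \<xi> (j + r) - \<xi> j" for j r
  proof (cases r)
    case (Suc q)
    have "W (Suc j) r = (\<Sum>i\<in>{Suc j..<j + r}. \<xi> i) + \<xi> (j + r)"
      by (simp add: W_def Suc)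
    moreover have "W j r = \<xi> j + (\<Sum>i\<in>{Suc j..<j + r}. \<xi> i)"
      by (simp add: W_def Suc sum.atLeast_Suc_lessThan)
    ultimately show ?thesis by simp
  qed (simp add: W_def)
  have Gstep: "\<xi> j = W j B / B - (G (Suc j) - G j)" for j
  proof -
    have "G (Suc j) - G j = (\<Sum>r<B. \<xi> (j + r) - \<xi> j) / B"
      by (simp add: G_def Wstep flip: diff_divide_distrib sum_subtractf)
    also have "(\<Sum>r<B. \<xi> (j + r) - \<xi> j) = W j B - B * \<xi> j"
      using sum.shift_bounds_nat_ivl[of \<xi> 0 j B]
      by (simp add: sum_subtractf W_def lessThan_atLeast0 add.commute)
    finally show ?thesis using B by (simp add: field_simps)
  qed
  have parts: "(\<Sum>j\<le>k. (G (Suc j) - G j) * f j)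
      = G (Suc k) * f (Suc k) - G 0 * f 0 - (\<Sum>j\<le>k. G (Suc j) * (f (Suc j) - f j))" for k
    by (induction k) (simp_all add: algebra_simps)
  have "(\<Sum>j\<le>n. \<xi> j * f j) = (\<Sum>j\<le>n. W j B / B * f j) - (\<Sum>j\<le>n. (G (Suc j) - G j) * f j)"
    by (subst Gstep) (simp add: left_diff_distrib sum_subtractf)
  also have "\<dots> = (\<Sum>j\<le>n. W j B / B * f j) + (\<Sum>j\<le>n. G (Suc j) * (f (Suc j) - f j))"
    using f by (simp add: parts)
  also have "\<bar>\<dots>\<bar> \<le> (\<Sum>j\<le>n. s / B * f j) + (\<Sum>j\<le>n. s * \<bar>f (Suc j) - f j\<bar>)"
  proof (intro order_trans[OF abs_triangle_ineq] add_mono order_trans[OF sum_abs] sum_mono)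
    fix j
    show "\<bar>W j B / real B * f j\<bar> \<le> s / real B * f j"
      using WB[of B j] f(1)[of j] B by (auto simp: abs_mult intro!: mult_right_mono divide_right_mono)
    show "\<bar>G (Suc j) * (f (Suc j) - f j)\<bar> \<le> s * \<bar>f (Suc j) - f j\<bar>"
      using GB[of "Suc j"] by (simp add: abs_mult mult_right_mono)
  qed
  finally show ?thesis by (simp add: sum_distrib_left)
qed

lemma sum_shift_site:
  fixes y :: "nat \<Rightarrow> real" and g :: "real \<Rightarrow> real"
  assumes "y 0 = 0" "y (Suc n) = 0"
  shows "(\<Sum>j\<le>n. g (real j) * y (Suc j)) = (\<Sum>j\<le>n. g (real j - 1) * y j)"
proof -
  have "(\<Sum>j\<le>n. g (real j) * y (Suc j)) = (\<Sum>j\<le>n. g (real (Suc j) - 1) * y (Suc j))" by simp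
  also have "\<dots> = (\<Sum>j\<le>Suc n. g (real j - 1) * y j)"
    by (subst sum.atMost_Suc_shift) (simp add: assms)
  finally show ?thesis using assms by simp
qed

text \<open>With \<open>\<alpha> = a\<close>, \<open>\<beta> = b\<close> this is the bilinear form of \<open>B B\<^sup>T\<close>, written as an inner product of
  \<open>B\<^sup>T x\<close> and \<open>B\<^sup>T y\<close>. Matrix rows correspond to the sites \<open>1, \<dots>, n\<close>; the sites \<open>0\<close> and
  \<open>n + 1\<close> are added so that no edge is special.\<close>

definition edge_form :: "nat \<Rightarrow> (nat \<Rightarrow> real) \<Rightarrow> (nat \<Rightarrow> real) \<Rightarrow> (nat \<Rightarrow> real) \<Rightarrow> (nat \<Rightarrow> real) \<Rightarrow> real" where
  "edge_form n \<alpha> \<beta> x y = (\<Sum>j\<le>n. (\<alpha> j * x j + \<beta> j * x (Suc j)) * (\<alpha> j * y j + \<beta> j * y (Suc j)))"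

definition mass :: "nat \<Rightarrow> (nat \<Rightarrow> real) \<Rightarrow> real" where
  "mass n x = (\<Sum>j\<le>n. (x j)\<^sup>2)"

definition dirichlet :: "nat \<Rightarrow> (nat \<Rightarrow> real) \<Rightarrow> bool" where
  "dirichlet n x \<longleftrightarrow> x 0 = 0 \<and> x (Suc n) = 0"

lemma mass_shift: "dirichlet n x \<Longrightarrow> (\<Sum>j\<le>n. (x (Suc j))\<^sup>2) = mass n x"
  using sum_shift_site[of "\<lambda>j. (x j)\<^sup>2" n "\<lambda>_. 1"] by (simp add: dirichlet_def mass_def)

lemma mass_nonneg: "mass n x \<ge> 0"
  by (simp add: mass_def sum_nonneg)

text \<open>The deterministic setting. The squares \<open>\<alpha>\<^sub>j\<^sup>2\<close> and \<open>\<beta>\<^sub>j\<^sup>2\<close> fluctuate around the chi-square means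
  \<open>m - n + j\<close> and \<open>j\<close>, and all windows of at most \<open>B\<close> fluctuations are bounded by \<open>s\<close>. The windows
  range over all positions, so coefficients of a matrix are extended to all indices before they enter here.\<close>

locale noisy_bidiagonal =
  fixes n m B :: nat and s \<theta> :: real and \<alpha> \<beta> :: "nat \<Rightarrow> real"
  assumes \<alpha>_nonneg: "\<And>j. \<alpha> j \<ge> 0" and \<beta>_nonneg: "\<And>j. \<beta> j \<ge> 0"
    and n_le_m: "n \<le> m" and B_pos: "B \<ge> 1"
    and \<theta>_pos: "\<theta> > 0" and \<theta>_sq: "\<theta>\<^sup>2 * m = n"
    and small_noise: "32 * s \<le> n" and n_large: "n \<ge> 4"
    and \<alpha>_windows: "\<And>u L. L \<le> B \<Longrightarrow> \<bar>\<Sum>i\<in>{u..<u + L}. (\<alpha> i)\<^sup>2 - (real m - real n + real i)\<bar> \<le> s"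
    and \<beta>_windows: "\<And>u L. L \<le> B \<Longrightarrow> \<bar>\<Sum>i\<in>{u..<u + L}. (\<beta> i)\<^sup>2 - real i\<bar> \<le> s"
begin

text \<open>Here \<open>\<theta> = (n / m)\<^sup>1\<^sup>/\<^sup>2\<close> and \<open>r = (n m)\<^sup>1\<^sup>/\<^sup>2\<close>, so \<open>edge\<close> is \<open>(m\<^sup>1\<^sup>/\<^sup>2 + n\<^sup>1\<^sup>/\<^sup>2)\<^sup>2\<close>, the unnormalized
  spectral edge, and \<open>\<kappa>\<close> is the slope of the potential. The weight \<open>c j\<close> is the linear surrogate for twice
  the hopping coefficient \<open>\<alpha>\<^sub>j \<beta>\<^sub>j\<close>, and the two parts below come from
  \<open>x y = (x\<^sup>2 + y\<^sup>2) / 2 - (x - y)\<^sup>2 / 2\<close>.\<close>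

definition "\<kappa> = 2 + \<theta> + 1 / \<theta>"
definition "r = \<theta> * m"
definition "edge = m + n + 2 * r"
definition "c j = \<theta> * (\<alpha> j)\<^sup>2 + (\<beta> j)\<^sup>2 / \<theta>"
definition "linear_part x = (\<Sum>j\<le>n. (\<alpha> j)\<^sup>2 * (x j)\<^sup>2 + (\<beta> j)\<^sup>2 * (x (Suc j))\<^sup>2
     + c j * ((x j)\<^sup>2 + (x (Suc j))\<^sup>2) / 2)"
definition "gradient_part x = (\<Sum>j\<le>n. c j * (\<bar>x j\<bar> - \<bar>x (Suc j)\<bar>)\<^sup>2 / 2)"
definition "variation x = (\<Sum>j\<le>n. \<bar>(x (Suc j))\<^sup>2 - (x j)\<^sup>2\<bar>)"

lemma m_pos: "m > 0" using n_large n_le_m by simp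

lemma \<theta>_le_1: "\<theta> \<le> 1"
proof -
  have "\<theta>\<^sup>2 * real m \<le> 1 * real m" using n_le_m unfolding \<theta>_sq by simp
  then have "\<theta>\<^sup>2 \<le> 1" using m_pos by (meson mult_right_le_imp_le of_nat_0_less_iff)
  then show ?thesis using \<theta>_pos by (simp add: power2_le_iff_abs_le abs_square_le_1)
qed

lemma r_eq: "r = n / \<theta>"
  using \<theta>_sq \<theta>_pos by (simp add: r_def field_simps power2_eq_square)

lemma n_le_r: "n \<le> r"
  using \<theta>_le_1 \<theta>_pos unfolding r_eq by (simp add: pos_le_divide_eq mult_left_le)

lemma r_pos: "r > 0" using n_le_r n_large by linarith

lemma \<kappa>_ge: "\<kappa> \<ge> 3" "\<kappa> > 0"
proof -
  have "1 / \<theta> \<ge> 1" using \<theta>_pos \<theta>_le_1 by simp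
  then show "\<kappa> \<ge> 3" "\<kappa> > 0" using \<theta>_pos unfolding \<kappa>_def by linarith+
qed

lemma s_nonneg: "s \<ge> 0"
  using \<alpha>_windows[of 0 0] by simp

lemma pointwise_\<alpha>: "\<bar>(\<alpha> j)\<^sup>2 - (real m - real n + real j)\<bar> \<le> s"
  using \<alpha>_windows[of 1 j] B_pos by simp

lemma pointwise_\<beta>: "\<bar>(\<beta> j)\<^sup>2 - real j\<bar> \<le> s"
  using \<beta>_windows[of 1 j] B_pos by simp

lemma c_nonneg: "c j \<ge> 0"
  using \<theta>_pos by (simp add: c_def)

text \<open>The restriction to the lower half is essential: for \<open>m = n\<close> the weights degenerate at the top left corner.\<close>

lemma c_lower: "c j \<ge> r / 4" if "n \<le> 2 * j"
proof -
  have "real n \<le> 2 * real j" using that by linarith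
  then have "(\<alpha> j)\<^sup>2 \<ge> m / 4"
    using pointwise_\<alpha>[of j] small_noise n_le_m by (simp add: abs_le_iff)
  then have "\<theta> * (\<alpha> j)\<^sup>2 \<ge> \<theta> * (m / 4)" using \<theta>_pos by (intro mult_left_mono) auto
  then show ?thesis using \<theta>_pos by (simp add: c_def r_def add_increasing2)
qed

lemma c_upper: "c j \<le> 4 * r" if "j \<le> n"
proof -
  have "(\<alpha> j)\<^sup>2 \<le> 2 * m" "(\<beta> j)\<^sup>2 \<le> 2 * n"
    using pointwise_\<alpha>[of j] pointwise_\<beta>[of j] small_noise n_le_m that by (auto simp: abs_le_iff)
  then have "\<theta> * (\<alpha> j)\<^sup>2 \<le> \<theta> * (2 * m)" "(\<beta> j)\<^sup>2 / \<theta> \<le> 2 * n / \<theta>"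
    using \<theta>_pos by (auto intro!: mult_left_mono divide_right_mono)
  then show ?thesis using r_eq by (simp add: c_def r_def)
qed

lemma hopping_upper: "\<alpha> j * \<beta> j \<le> 2 * m" if "j \<le> n"
proof -
  have "2 * (\<alpha> j * \<beta> j) \<le> (\<alpha> j)\<^sup>2 + (\<beta> j)\<^sup>2"
    using sum_squares_bound[of "\<alpha> j" "\<beta> j"] by (simp add: mult.assoc)
  also have "\<dots> \<le> 2 * m + 2 * n"
    using pointwise_\<alpha>[of j] pointwise_\<beta>[of j] small_noise n_le_m that by (auto simp: abs_le_iff)
  finally show ?thesis using n_le_m by simp
qed

lemma hopping_le: "2 * (\<alpha> j * \<beta> j) \<le> c j"
proof -
  have "0 \<le> (\<theta> * \<alpha> j - \<beta> j)\<^sup>2 / \<theta>" using \<theta>_pos by simp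
  also have "\<dots> = c j - 2 * (\<alpha> j * \<beta> j)"
    using \<theta>_pos by (simp add: c_def field_simps power2_eq_square)
  finally show ?thesis by simp
qed

text \<open>With \<open>P = \<theta> \<alpha>\<^sup>2\<close> and \<open>R = \<beta>\<^sup>2 / \<theta>\<close>, the defect in the arithmetic-geometric mean inequality is
  \<open>(\<surd>P - \<surd>R)\<^sup>2 \<le> (P - R)\<^sup>2 / (P + R)\<close>. Near the corner \<open>P\<close> and \<open>R\<close> have almost equal means, so the
  defect is quadratic in the noise.\<close>

lemma hopping_ge:
  assumes "c j > 0"
  shows "c j - (\<theta> * (\<alpha> j)\<^sup>2 - (\<beta> j)\<^sup>2 / \<theta>)\<^sup>2 / c j \<le> 2 * (\<alpha> j * \<beta> j)"
proof -
  define P where "P = \<theta> * (\<alpha> j)\<^sup>2"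
  define R where "R = (\<beta> j)\<^sup>2 / \<theta>"
  define h where "h = 2 * (\<alpha> j * \<beta> j)"
  have h: "h\<^sup>2 = 4 * P * R" using \<theta>_pos by (simp add: h_def P_def R_def power2_eq_square)
  have cPR: "c j = P + R" by (simp add: c_def P_def R_def)
  have "0 \<le> h" using \<alpha>_nonneg \<beta>_nonneg by (simp add: h_def)
  have "h \<le> c j" using hopping_le by (simp add: h_def)
  have "c j * c j - (P - R)\<^sup>2 = h * h"
    using h unfolding cPR by (simp add: power2_eq_square algebra_simps)
  also have "\<dots> \<le> h * c j" using \<open>0 \<le> h\<close> \<open>h \<le> c j\<close> by (rule mult_left_mono[rotated])
  finally have "c j - (P - R)\<^sup>2 / c j \<le> h" using assms by (simp add: field_simps)
  then show ?thesis by (simp add: P_def R_def h_def)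
qed

lemma edge_form_expand:
  "edge_form n \<alpha> \<beta> x x = (\<Sum>j\<le>n. (\<alpha> j)\<^sup>2 * (x j)\<^sup>2 + (\<beta> j)\<^sup>2 * (x (Suc j))\<^sup>2
     + 2 * (\<alpha> j * \<beta> j) * (x j * x (Suc j)))"
  by (simp add: edge_form_def power2_eq_square algebra_simps)

lemma abs_prod_eq: "\<bar>u * v\<bar> = (u\<^sup>2 + v\<^sup>2) / 2 - (\<bar>u\<bar> - \<bar>v\<bar>)\<^sup>2 / 2" for u v :: real
  by (simp add: power2_eq_square abs_mult field_simps)

text \<open>As the coefficients are nonnegative, replacing the entries of \<open>x\<close> by their absolute values can only increase the form;
  this is why the gradient is taken of \<open>\<bar>x\<bar>\<close>.\<close>

lemma edge_form_le: "edge_form n \<alpha> \<beta> x x \<le> linear_part x - gradient_part x"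
proof -
  have "2 * (\<alpha> j * \<beta> j) * (x j * x (Suc j))
      \<le> c j * (((x j)\<^sup>2 + (x (Suc j))\<^sup>2) / 2 - (\<bar>x j\<bar> - \<bar>x (Suc j)\<bar>)\<^sup>2 / 2)" for j
  proof -
    have "2 * (\<alpha> j * \<beta> j) * (x j * x (Suc j)) \<le> 2 * (\<alpha> j * \<beta> j) * \<bar>x j * x (Suc j)\<bar>"
      using \<alpha>_nonneg \<beta>_nonneg by (intro mult_left_mono) auto
    also have "\<dots> \<le> c j * \<bar>x j * x (Suc j)\<bar>" by (intro mult_right_mono hopping_le) auto
    finally show ?thesis unfolding abs_prod_eq .
  qed
  then show ?thesis
    unfolding edge_form_expand linear_part_def gradient_part_def sum_subtractf[symmetric]
    by (intro sum_mono) (simp add: right_diff_distrib)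
qed

text \<open>The defect \<open>\<epsilon>\<close> of the linear surrogate has to be controlled only on edges met by \<open>x\<close>, that is, near the corner
  for a localized test vector.\<close>

lemma edge_form_ge:
  assumes x: "\<And>j. x j \<ge> 0" and dir: "dirichlet n x"
    and e: "\<And>j. j \<le> n \<Longrightarrow> x j \<noteq> 0 \<or> x (Suc j) \<noteq> 0 \<Longrightarrow> c j - \<epsilon> \<le> 2 * (\<alpha> j * \<beta> j)"
    and \<epsilon>: "\<epsilon> \<ge> 0"
  shows "linear_part x - gradient_part x - \<epsilon> * mass n x \<le> edge_form n \<alpha> \<beta> x x"
proof -
  have "c j * (((x j)\<^sup>2 + (x (Suc j))\<^sup>2) / 2 - (\<bar>x j\<bar> - \<bar>x (Suc j)\<bar>)\<^sup>2 / 2) - \<epsilon> * (((x j)\<^sup>2 + (x (Suc j))\<^sup>2) / 2)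
      \<le> 2 * (\<alpha> j * \<beta> j) * (x j * x (Suc j))" if j: "j \<le> n" for j
  proof (cases "x j \<noteq> 0 \<or> x (Suc j) \<noteq> 0")
    case True
    have "(c j - \<epsilon>) * (x j * x (Suc j)) \<le> 2 * (\<alpha> j * \<beta> j) * (x j * x (Suc j))"
      using x by (intro mult_right_mono e[OF j True]) auto
    moreover have "\<epsilon> * (x j * x (Suc j)) \<le> \<epsilon> * (((x j)\<^sup>2 + (x (Suc j))\<^sup>2) / 2)"
      using sum_squares_bound[of "x j" "x (Suc j)"] \<epsilon> by (intro mult_left_mono) auto
    moreover have "x j * x (Suc j) = ((x j)\<^sup>2 + (x (Suc j))\<^sup>2) / 2 - (\<bar>x j\<bar> - \<bar>x (Suc j)\<bar>)\<^sup>2 / 2"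
      using abs_prod_eq[of "x j" "x (Suc j)"] x by simp
    ultimately show ?thesis by (simp add: left_diff_distrib)
  qed simp
  then have "(\<Sum>j\<le>n. (\<alpha> j)\<^sup>2 * (x j)\<^sup>2 + (\<beta> j)\<^sup>2 * (x (Suc j))\<^sup>2 + (c j * (((x j)\<^sup>2 + (x (Suc j))\<^sup>2) / 2 - (\<bar>x j\<bar> - \<bar>x (Suc j)\<bar>)\<^sup>2 / 2) - \<epsilon> * (((x j)\<^sup>2 + (x (Suc j))\<^sup>2) / 2)))
     \<le> edge_form n \<alpha> \<beta> x x"
    unfolding edge_form_expand by (intro sum_mono add_mono order_refl) auto
  moreover have "(\<Sum>j\<le>n. \<epsilon> * (((x j)\<^sup>2 + (x (Suc j))\<^sup>2) / 2)) = \<epsilon> * mass n x"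
    using mass_shift[OF dir] by (simp add: sum.distrib mass_def flip: sum_distrib_left sum_divide_distrib)
  ultimately show ?thesis
    unfolding linear_part_def gradient_part_def
    by (simp add: sum.distrib sum_subtractf right_diff_distrib)
qed

text \<open>The shifted sum differs from the unshifted one by the variation weighted with single entries, which are themselves
  windows of length one.\<close>

lemma noise_bound:
  assumes dir: "dirichlet n x"
    and win: "\<And>u L. L \<le> B \<Longrightarrow> \<bar>\<Sum>i\<in>{u..<u + L}. \<xi> i\<bar> \<le> s"
  shows "\<bar>\<Sum>j\<le>n. \<xi> j * (x j)\<^sup>2\<bar> \<le> s / B * mass n x + 2 * s * variation x"
    and "\<bar>\<Sum>j\<le>n. \<xi> j * (x (Suc j))\<^sup>2\<bar> \<le> s / B * mass n x + 2 * s * variation x"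
proof -
  have 1: "\<bar>\<Sum>j\<le>n. \<xi> j * (x j)\<^sup>2\<bar> \<le> s / B * mass n x + s * variation x"
    unfolding mass_def variation_def
    by (rule summation_by_parts_windows[OF B_pos win]) (use dir in \<open>auto simp: dirichlet_def\<close>)
  have V: "s * variation x \<ge> 0" using s_nonneg by (simp add: variation_def sum_nonneg)
  show "\<bar>\<Sum>j\<le>n. \<xi> j * (x j)\<^sup>2\<bar> \<le> s / B * mass n x + 2 * s * variation x"
    using 1 V by linarith
  have pt: "\<bar>\<xi> j\<bar> \<le> s" for j using win[of 1 j] B_pos by simp
  have "\<bar>\<Sum>j\<le>n. \<xi> j * ((x (Suc j))\<^sup>2 - (x j)\<^sup>2)\<bar> \<le> (\<Sum>j\<le>n. s * \<bar>(x (Suc j))\<^sup>2 - (x j)\<^sup>2\<bar>)"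
    by (intro order_trans[OF sum_abs] sum_mono) (simp add: abs_mult mult_right_mono pt)
  then have 2: "\<bar>\<Sum>j\<le>n. \<xi> j * ((x (Suc j))\<^sup>2 - (x j)\<^sup>2)\<bar> \<le> s * variation x"
    by (simp add: variation_def sum_distrib_left)
  have "(\<Sum>j\<le>n. \<xi> j * (x (Suc j))\<^sup>2) = (\<Sum>j\<le>n. \<xi> j * (x j)\<^sup>2) + (\<Sum>j\<le>n. \<xi> j * ((x (Suc j))\<^sup>2 - (x j)\<^sup>2))"
    by (simp add: right_diff_distrib sum_subtractf)
  then show "\<bar>\<Sum>j\<le>n. \<xi> j * (x (Suc j))\<^sup>2\<bar> \<le> s / B * mass n x + 2 * s * variation x"
    using 1 2 by linarith
qed

text \<open>The choice of \<open>\<theta>\<close> with \<open>\<theta> m = n / \<theta>\<close> is what makes the mean potential exactly linear in the distance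
  \<open>n - j\<close> to the corner.\<close>

lemma mean_part:
  assumes dir: "dirichlet n x"
  defines "d \<equiv> \<lambda>j::nat. real m - real n + real j"
  shows "(1 + \<theta> / 2) * (\<Sum>j\<le>n. d j * (x j)\<^sup>2) + \<theta> / 2 * (\<Sum>j\<le>n. d j * (x (Suc j))\<^sup>2)
     + 1 / (2 * \<theta>) * (\<Sum>j\<le>n. real j * (x j)\<^sup>2) + (1 + 1 / (2 * \<theta>)) * (\<Sum>j\<le>n. real j * (x (Suc j))\<^sup>2)
     = (\<Sum>j\<le>n. (edge - \<kappa> * (n - j) - \<kappa> / 2) * (x j)\<^sup>2)"
proof -
  have sh1: "(\<Sum>j\<le>n. d j * (x (Suc j))\<^sup>2) = (\<Sum>j\<le>n. (d j - 1) * (x j)\<^sup>2)"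
    using sum_shift_site[of "\<lambda>j. (x j)\<^sup>2" n "\<lambda>j. real m - real n + j"] dir
    by (simp add: dirichlet_def d_def algebra_simps)
  have sh2: "(\<Sum>j\<le>n. real j * (x (Suc j))\<^sup>2) = (\<Sum>j\<le>n. (real j - 1) * (x j)\<^sup>2)"
    using sum_shift_site[of "\<lambda>j. (x j)\<^sup>2" n "\<lambda>j. j"] dir by (simp add: dirichlet_def)
  have coeff: "(1 + \<theta> / 2) * d j + \<theta> / 2 * (d j - 1) + 1 / (2 * \<theta>) * j + (1 + 1 / (2 * \<theta>)) * (real j - 1)
      = edge - \<kappa> * (n - j) - \<kappa> / 2" if "j \<le> n" for j
  proof -
    have "edge = m + n + \<theta> * m + n / \<theta>" using r_eq by (simp add: edge_def r_def)
    then show ?thesis using that \<theta>_pos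
      by (simp add: \<kappa>_def d_def of_nat_diff field_simps)
  qed
  show ?thesis unfolding sh1 sh2 sum_distrib_left sum.distrib[symmetric]
  proof (intro sum.cong refl)
    fix j assume "j \<in> {..n}"
    then have j: "j \<le> n" by simp
    show "(1 + \<theta> / 2) * (d j * (x j)\<^sup>2) + \<theta> / 2 * ((d j - 1) * (x j)\<^sup>2) + 1 / (2 * \<theta>) * (real j * (x j)\<^sup>2)
        + (1 + 1 / (2 * \<theta>)) * ((real j - 1) * (x j)\<^sup>2) = (edge - \<kappa> * (n - j) - \<kappa> / 2) * (x j)\<^sup>2"
      unfolding coeff[OF j, symmetric] by (simp only: distrib_right mult.assoc)
  qed
qed

lemma linear_part_close:
  assumes dir: "dirichlet n x"
  shows "\<bar>linear_part x - (\<Sum>j\<le>n. (edge - \<kappa> * (n - j) - \<kappa> / 2) * (x j)\<^sup>2)\<bar>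
     \<le> \<kappa> * (s / B * mass n x + 2 * s * variation x)"
proof -
  define d where "d = (\<lambda>j::nat. real m - real n + real j)"
  define \<xi> where "\<xi> = (\<lambda>j. (\<alpha> j)\<^sup>2 - d j)"
  define \<eta> where "\<eta> = (\<lambda>j. (\<beta> j)\<^sup>2 - real j)"
  define T where "T = s / B * mass n x + 2 * s * variation x"
  have lin: "linear_part x = (1 + \<theta> / 2) * (\<Sum>j\<le>n. (\<alpha> j)\<^sup>2 * (x j)\<^sup>2) + \<theta> / 2 * (\<Sum>j\<le>n. (\<alpha> j)\<^sup>2 * (x (Suc j))\<^sup>2)
     + 1 / (2 * \<theta>) * (\<Sum>j\<le>n. (\<beta> j)\<^sup>2 * (x j)\<^sup>2) + (1 + 1 / (2 * \<theta>)) * (\<Sum>j\<le>n. (\<beta> j)\<^sup>2 * (x (Suc j))\<^sup>2)"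
    unfolding linear_part_def sum_distrib_left sum.distrib[symmetric]
    using \<theta>_pos by (intro sum.cong refl) (simp add: c_def field_simps)
  have w\<xi>: "\<bar>\<Sum>i\<in>{u..<u + L}. \<xi> i\<bar> \<le> s" if "L \<le> B" for u L
    using \<alpha>_windows[OF that] by (simp add: \<xi>_def d_def)
  have w\<eta>: "\<bar>\<Sum>i\<in>{u..<u + L}. \<eta> i\<bar> \<le> s" if "L \<le> B" for u L
    using \<beta>_windows[OF that] by (simp add: \<eta>_def)
  have "linear_part x - (\<Sum>j\<le>n. (edge - \<kappa> * (n - j) - \<kappa> / 2) * (x j)\<^sup>2)
     = (1 + \<theta> / 2) * (\<Sum>j\<le>n. \<xi> j * (x j)\<^sup>2) + \<theta> / 2 * (\<Sum>j\<le>n. \<xi> j * (x (Suc j))\<^sup>2)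
     + 1 / (2 * \<theta>) * (\<Sum>j\<le>n. \<eta> j * (x j)\<^sup>2) + (1 + 1 / (2 * \<theta>)) * (\<Sum>j\<le>n. \<eta> j * (x (Suc j))\<^sup>2)"
    unfolding lin mean_part[OF dir, symmetric]
    by (simp add: \<xi>_def \<eta>_def d_def left_diff_distrib sum_subtractf right_diff_distrib)
  moreover have "\<bar>p * y\<bar> \<le> p * T" if "0 \<le> p" "\<bar>y\<bar> \<le> T" for p y
    using that by (simp add: abs_mult mult_left_mono)
  then have "\<bar>(1 + \<theta> / 2) * (\<Sum>j\<le>n. \<xi> j * (x j)\<^sup>2)\<bar> \<le> (1 + \<theta> / 2) * T"
    "\<bar>\<theta> / 2 * (\<Sum>j\<le>n. \<xi> j * (x (Suc j))\<^sup>2)\<bar> \<le> \<theta> / 2 * T"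
    "\<bar>1 / (2 * \<theta>) * (\<Sum>j\<le>n. \<eta> j * (x j)\<^sup>2)\<bar> \<le> 1 / (2 * \<theta>) * T"
    "\<bar>(1 + 1 / (2 * \<theta>)) * (\<Sum>j\<le>n. \<eta> j * (x (Suc j))\<^sup>2)\<bar> \<le> (1 + 1 / (2 * \<theta>)) * T"
    using noise_bound[OF dir w\<xi>, folded T_def] noise_bound[OF dir w\<eta>, folded T_def] \<theta>_pos
    by (auto simp del: abs_mult times_divide_eq_left divide_inverse)
  moreover have "(1 + \<theta> / 2) * T + \<theta> / 2 * T + 1 / (2 * \<theta>) * T + (1 + 1 / (2 * \<theta>)) * T = \<kappa> * T"
    by (simp add: \<kappa>_def field_simps)
  ultimately show ?thesis unfolding T_def[symmetric] by linarith
qed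

text \<open>Edge by edge. In the lower half the variation \<open>\<bar>x\<^sup>2 - y\<^sup>2\<bar> = \<bar>x - y\<bar> (x + y)\<close> is split by Young's
  inequality between the gradient and the mass. In the upper half the gradient may be too weak, but there the potential is
  of order \<open>n\<close> and beats the noise outright.\<close>

lemma variation_absorbed:
  assumes dir: "dirichlet n x"
  shows "2 * \<kappa> * s * variation x - gradient_part x
     \<le> 32 * \<kappa>\<^sup>2 * s\<^sup>2 / r * mass n x + \<kappa> / 2 * (\<Sum>j\<le>n. (real n - real j) * (x j)\<^sup>2)"
proof -
  define \<delta> where "\<delta> = 16 * \<kappa>\<^sup>2 * s\<^sup>2 / r"
  define \<tau> where "\<tau> = 2 * \<kappa> * s"
  have \<tau>: "\<tau> \<ge> 0" and \<delta>: "\<delta> \<ge> 0"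
    using \<kappa>_ge s_nonneg r_pos by (auto simp: \<tau>_def \<delta>_def)
  define pot where "pot = (\<lambda>j. (real n - real j) * (x j)\<^sup>2)"
  have pot: "pot j \<ge> 0" if "j \<le> Suc n" for j
    using that dir by (cases "j = Suc n") (auto simp: pot_def dirichlet_def)
  have edge: "\<tau> * \<bar>(x (Suc j))\<^sup>2 - (x j)\<^sup>2\<bar> - c j * (\<bar>x j\<bar> - \<bar>x (Suc j)\<bar>)\<^sup>2 / 2
      \<le> \<delta> * ((x j)\<^sup>2 + (x (Suc j))\<^sup>2) + \<kappa> / 4 * (pot j + pot (Suc j))" if j: "j \<le> n" for j
  proof (cases "n \<le> 2 * j")
    case True
    define u where "u = \<bar>\<bar>x j\<bar> - \<bar>x (Suc j)\<bar>\<bar>"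
    define v where "v = \<bar>x j\<bar> + \<bar>x (Suc j)\<bar>"
    have c: "c j \<ge> r / 4" "c j > 0" using c_lower[OF True] r_pos by auto
    have uv: "\<bar>(x (Suc j))\<^sup>2 - (x j)\<^sup>2\<bar> = u * v"
    proof -
      have "(x j)\<^sup>2 - (x (Suc j))\<^sup>2 = (\<bar>x j\<bar> - \<bar>x (Suc j)\<bar>) * v"
        by (simp add: v_def power2_eq_square algebra_simps flip: abs_mult)
      then have "\<bar>(x j)\<^sup>2 - (x (Suc j))\<^sup>2\<bar> = u * v" by (simp add: u_def v_def abs_mult)
      then show ?thesis by (simp add: abs_minus_commute)
    qed
    have v2: "v\<^sup>2 \<le> 2 * ((x j)\<^sup>2 + (x (Suc j))\<^sup>2)"
      using sum_squares_bound[of "\<bar>x j\<bar>" "\<bar>x (Suc j)\<bar>"] by (simp add: v_def power2_sum)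
    \<comment> \<open>Young's inequality with the weight that spends the whole gradient term of this edge.\<close>
    have "0 \<le> (c j * u - \<tau> * v)\<^sup>2 / (2 * c j)" using c by simp
    also have "\<dots> = c j * u\<^sup>2 / 2 - \<tau> * (u * v) + \<tau>\<^sup>2 * v\<^sup>2 / (2 * c j)"
      using c by (simp add: power2_eq_square field_simps)
    finally have "\<tau> * (u * v) - c j * u\<^sup>2 / 2 \<le> \<tau>\<^sup>2 * v\<^sup>2 / (2 * c j)" by simp
    also have "\<dots> \<le> \<tau>\<^sup>2 * v\<^sup>2 / (2 * (r / 4))"
      using c r_pos by (intro divide_left_mono mult_left_mono) auto
    also have "\<dots> = \<delta> / 2 * v\<^sup>2" by (simp add: \<tau>_def \<delta>_def power2_eq_square)
    also have "\<dots> \<le> \<delta> / 2 * (2 * ((x j)\<^sup>2 + (x (Suc j))\<^sup>2))"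
      using \<delta> by (intro mult_left_mono v2) auto
    also have "\<dots> = \<delta> * ((x j)\<^sup>2 + (x (Suc j))\<^sup>2)" by (simp add: field_simps)
    finally have "\<tau> * (u * v) - c j * u\<^sup>2 / 2 \<le> \<delta> * ((x j)\<^sup>2 + (x (Suc j))\<^sup>2)" .
    moreover have "\<kappa> / 4 * (pot j + pot (Suc j)) \<ge> 0"
      using pot[of j] pot[of "Suc j"] j \<kappa>_ge by simp
    ultimately show ?thesis by (simp add: uv u_def)
  next
    case False
    then have jn: "real n - real (Suc j) \<ge> n / 4" "real n - real j \<ge> n / 4"
      using n_large by linarith+
    have "\<bar>(x (Suc j))\<^sup>2 - (x j)\<^sup>2\<bar> \<le> (x j)\<^sup>2 + (x (Suc j))\<^sup>2" by (simp add: abs_le_iff)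
    then have "\<tau> * \<bar>(x (Suc j))\<^sup>2 - (x j)\<^sup>2\<bar> \<le> \<tau> * ((x j)\<^sup>2 + (x (Suc j))\<^sup>2)"
      using \<tau> by (rule mult_left_mono)
    also have "\<dots> \<le> \<kappa> * (n / 16) * ((x j)\<^sup>2 + (x (Suc j))\<^sup>2)"
      unfolding \<tau>_def using small_noise \<kappa>_ge by (intro mult_right_mono) auto
    also have "\<dots> = \<kappa> / 4 * (n / 4 * (x j)\<^sup>2 + n / 4 * (x (Suc j))\<^sup>2)" by (simp add: algebra_simps)
    also have "\<dots> \<le> \<kappa> / 4 * (pot j + pot (Suc j))"
      unfolding pot_def using jn \<kappa>_ge by (intro mult_left_mono add_mono mult_right_mono) auto
    finally have "\<tau> * \<bar>(x (Suc j))\<^sup>2 - (x j)\<^sup>2\<bar> \<le> \<kappa> / 4 * (pot j + pot (Suc j))" .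
    moreover have "0 \<le> c j * (\<bar>x j\<bar> - \<bar>x (Suc j)\<bar>)\<^sup>2 / 2" using c_nonneg[of j] by simp
    moreover have "0 \<le> \<delta> * ((x j)\<^sup>2 + (x (Suc j))\<^sup>2)" using \<delta> by simp
    ultimately show ?thesis by linarith
  qed
  \<comment> \<open>The potential at site \<open>n + 1\<close> is \<open>-1\<close>, but that site is empty.\<close>
  have potsum: "(\<Sum>j\<le>n. pot (Suc j)) \<le> (\<Sum>j\<le>n. pot j)"
  proof -
    have "(\<Sum>j\<le>n. pot (Suc j)) = (\<Sum>j\<le>n. pot j) + pot (Suc n) - pot 0"
      using sum.atMost_Suc_shift[of pot n] by simp
    then show ?thesis using dir by (simp add: pot_def dirichlet_def)
  qed
  have "2 * \<kappa> * s * variation x - gradient_part x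
      = (\<Sum>j\<le>n. \<tau> * \<bar>(x (Suc j))\<^sup>2 - (x j)\<^sup>2\<bar> - c j * (\<bar>x j\<bar> - \<bar>x (Suc j)\<bar>)\<^sup>2 / 2)"
    by (simp add: variation_def gradient_part_def sum_subtractf \<tau>_def sum_distrib_left)
  also have "\<dots> \<le> (\<Sum>j\<le>n. \<delta> * ((x j)\<^sup>2 + (x (Suc j))\<^sup>2) + \<kappa> / 4 * (pot j + pot (Suc j)))"
    by (intro sum_mono edge) auto
  also have "\<dots> = \<delta> * (2 * mass n x) + \<kappa> / 4 * ((\<Sum>j\<le>n. pot j) + (\<Sum>j\<le>n. pot (Suc j)))"
    using mass_shift[OF dir] unfolding sum.distrib sum_distrib_left[symmetric] mass_def by simp
  also have "\<dots> \<le> \<delta> * (2 * mass n x) + \<kappa> / 4 * (2 * (\<Sum>j\<le>n. pot j))"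
    using potsum \<kappa>_ge by (intro add_left_mono mult_left_mono) auto
  finally show ?thesis by (simp add: \<delta>_def pot_def)
qed

text \<open>Far from the corner half of the potential is spent on absorbing the noise, and the other half lowers the form.\<close>

lemma edge_form_upper:
  assumes dir: "dirichlet n x" and supp: "\<And>j. j \<le> n \<Longrightarrow> x j \<noteq> 0 \<Longrightarrow> K \<le> real n - real j"
  shows "edge_form n \<alpha> \<beta> x x \<le> (edge - \<kappa> * K / 2 + \<kappa> * s / B + 32 * \<kappa>\<^sup>2 * s\<^sup>2 / r) * mass n x"
proof -
  define pot where "pot = (\<Sum>j\<le>n. (real n - real j) * (x j)\<^sup>2)"
  have mean: "(\<Sum>j\<le>n. (edge - \<kappa> * (n - j) - \<kappa> / 2) * (x j)\<^sup>2) = (edge - \<kappa> / 2) * mass n x - \<kappa> * pot"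
  proof -
    have "(\<Sum>j\<le>n. (edge - \<kappa> * (n - j) - \<kappa> / 2) * (x j)\<^sup>2)
        = (\<Sum>j\<le>n. (edge - \<kappa> / 2) * (x j)\<^sup>2 - \<kappa> * ((real n - real j) * (x j)\<^sup>2))"
      by (intro sum.cong refl) (simp add: of_nat_diff algebra_simps)
    then show ?thesis by (simp add: sum_subtractf mass_def pot_def sum_distrib_left)
  qed
  have "K * mass n x \<le> pot"
    unfolding mass_def pot_def sum_distrib_left
  proof (intro sum_mono)
    fix j assume "j \<in> {..n}"
    then show "K * (x j)\<^sup>2 \<le> (real n - real j) * (x j)\<^sup>2"
      using supp[of j] by (cases "x j = 0") (auto intro: mult_right_mono)
  qed
  then have kp: "\<kappa> / 2 * (K * mass n x) \<le> \<kappa> / 2 * pot" using \<kappa>_ge by (intro mult_left_mono) auto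
  have "edge_form n \<alpha> \<beta> x x \<le> linear_part x - gradient_part x" by (rule edge_form_le)
  also have "linear_part x \<le> (edge - \<kappa> / 2) * mass n x - \<kappa> * pot + \<kappa> * (s / B * mass n x + 2 * s * variation x)"
    using linear_part_close[OF dir] unfolding mean by (simp add: abs_le_iff)
  finally have "edge_form n \<alpha> \<beta> x x \<le> (edge - \<kappa> / 2) * mass n x - \<kappa> * pot + \<kappa> * s / B * mass n x
      + (2 * \<kappa> * s * variation x - gradient_part x)"
    by (simp add: algebra_simps)
  also have "\<dots> \<le> (edge - \<kappa> / 2) * mass n x - \<kappa> * pot + \<kappa> * s / B * mass n x
      + (32 * \<kappa>\<^sup>2 * s\<^sup>2 / r * mass n x + \<kappa> / 2 * pot)"
    unfolding pot_def by (intro add_left_mono variation_absorbed dir)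
  also have "\<dots> = (edge - \<kappa> / 2 + \<kappa> * s / B + 32 * \<kappa>\<^sup>2 * s\<^sup>2 / r) * mass n x - \<kappa> / 2 * pot"
    by (simp add: algebra_simps)
  also have "\<dots> \<le> (edge - \<kappa> / 2 + \<kappa> * s / B + 32 * \<kappa>\<^sup>2 * s\<^sup>2 / r) * mass n x - \<kappa> / 2 * (K * mass n x)"
    using kp by simp
  also have "\<dots> = (edge - \<kappa> * K / 2 + \<kappa> * s / B + 32 * \<kappa>\<^sup>2 * s\<^sup>2 / r) * mass n x - \<kappa> / 2 * mass n x"
    by (simp add: algebra_simps)
  also have "\<dots> \<le> (edge - \<kappa> * K / 2 + \<kappa> * s / B + 32 * \<kappa>\<^sup>2 * s\<^sup>2 / r) * mass n x"
    using \<kappa>_ge mass_nonneg[of n x] by simp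
  finally show ?thesis .
qed

text \<open>Both ends of the support must be treated: the wave function has to vanish at site \<open>n + 1\<close> and to come back to zero
  within the scale \<open>B\<close>, at a gradient cost of order \<open>r / B\<^sup>2\<close> per unit of mass.\<close>

definition "tent j = max 0 (real B - \<bar>real j - (real n + 1 - real B)\<bar>)"

lemma tent_lipschitz: "\<bar>tent (Suc j) - tent j\<bar> \<le> 1"
  by (simp add: tent_def)

lemma tent_le: "tent j \<le> B" "tent j \<ge> 0"
  by (auto simp: tent_def)

lemma tent_support: "tent j \<noteq> 0 \<Longrightarrow> real n + 1 - 2 * real B < real j \<and> real j < real n + 1"
  by (auto simp: tent_def max_def split: if_splits)

lemma tent_dirichlet: "2 * B \<le> n \<Longrightarrow> dirichlet n tent"
  using tent_support[of 0] tent_support[of "Suc n"] by (auto simp: dirichlet_def)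

lemma sum_squares_ge: "real k ^ 3 / 3 \<le> (\<Sum>i<k. (real (Suc i))\<^sup>2)"
proof (induction k)
  case (Suc k)
  have "real (Suc k) ^ 3 / 3 = real k ^ 3 / 3 + real k ^ 2 + real k + 1 / 3"
    by (simp add: power3_eq_cube power2_eq_square field_simps)
  also have "\<dots> \<le> real k ^ 3 / 3 + (real (Suc k))\<^sup>2"
    by (simp add: power2_eq_square algebra_simps)
  finally show ?case using Suc by simp
qed simp

lemma tent_mass: assumes "2 * B \<le> n" shows "real B ^ 3 / 3 \<le> mass n tent"
proof -
  have "real B ^ 3 / 3 \<le> (\<Sum>i<B. (real (Suc i))\<^sup>2)" by (rule sum_squares_ge)
  also have "\<dots> = (\<Sum>i<B. (tent (n - i))\<^sup>2)"
    using assms by (intro sum.cong refl) (simp add: tent_def of_nat_diff)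
  also have "\<dots> = (\<Sum>j\<in>(\<lambda>i. n - i) ` {..<B}. (tent j)\<^sup>2)"
    using assms by (subst sum.reindex) (auto simp: inj_on_def)
  also have "\<dots> \<le> mass n tent"
    unfolding mass_def using assms by (intro sum_mono2) auto
  finally show ?thesis .
qed

text \<open>At most \<open>2 B\<close> edges touch the support of the tent.\<close>

lemma tent_edges:
  fixes g :: "nat \<Rightarrow> real"
  assumes B: "2 * B \<le> n" and g: "\<And>j. j \<le> n \<Longrightarrow> g j \<le> C" and C: "C \<ge> 0"
    and g0: "\<And>j. tent j = 0 \<Longrightarrow> tent (Suc j) = 0 \<Longrightarrow> g j = 0"
  shows "(\<Sum>j\<le>n. g j) \<le> 2 * real B * C"
proof -
  have "(\<Sum>j\<le>n. g j) = (\<Sum>j\<in>{n + 1 - 2 * B..n}. g j)"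
  proof (rule sum.mono_neutral_right)
    show "\<forall>i\<in>{..n} - {n + 1 - 2 * B..n}. g i = 0"
    proof
      fix j assume "j \<in> {..n} - {n + 1 - 2 * B..n}"
      then have "\<not> real n + 1 - 2 * real B < real j" "\<not> real n + 1 - 2 * real B < real (Suc j)"
        using B by auto
      then show "g j = 0" using tent_support g0 by blast
    qed
  qed auto
  also have "\<dots> \<le> real (card {n + 1 - 2 * B..n}) * C"
    by (intro sum_bounded_above g) auto
  also have "\<dots> = 2 * real B * C" using B B_pos by simp
  finally show ?thesis .
qed

text \<open>The tent sees the potential only up to depth \<open>2 B\<close>, has variation \<open>O(B\<^sup>2)\<close> and gradient \<open>O(r B)\<close>,
  against a mass of order \<open>B\<^sup>3\<close>.\<close>

lemma edge_form_tent:
  assumes B: "4 * B \<le> n" "2 * real B \<le> s"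
  shows "(edge - 2 * \<kappa> * B - \<kappa> / 2 - 25 * \<kappa> * s / B - 16 * \<kappa>\<^sup>2 * s\<^sup>2 / r - 12 * r / (real B)\<^sup>2) * mass n tent
     \<le> edge_form n \<alpha> \<beta> tent tent"
proof -
  have dir: "dirichlet n tent" using B by (intro tent_dirichlet) auto
  have Bp: "real B > 0" using B_pos by simp
  define \<epsilon> where "\<epsilon> = 16 * \<kappa>\<^sup>2 * s\<^sup>2 / r"
  have \<epsilon>: "\<epsilon> \<ge> 0" using r_pos by (simp add: \<epsilon>_def)
  have near: "real n - real j \<le> 2 * real B" "n \<le> 2 * j"
    if "tent j \<noteq> 0 \<or> tent (Suc j) \<noteq> 0" for j
  proof -
    have "real n + 1 - 2 * real B < real j + 1"
      using that tent_support[of j] tent_support[of "Suc j"] by auto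
    then show "real n - real j \<le> 2 * real B" "n \<le> 2 * j" using B by linarith+
  qed
  have hop: "c j - \<epsilon> \<le> 2 * (\<alpha> j * \<beta> j)"
    if jn: "j \<le> n" and j: "tent j \<noteq> 0 \<or> tent (Suc j) \<noteq> 0" for j
  proof -
    have cj: "c j \<ge> r / 4" "c j > 0" using c_lower[OF near(2)[OF j]] r_pos by auto
    define \<xi> where "\<xi> = (\<alpha> j)\<^sup>2 - (real m - real n + real j)"
    define \<eta> where "\<eta> = (\<beta> j)\<^sup>2 - real j"
    have "\<theta> * (\<alpha> j)\<^sup>2 - (\<beta> j)\<^sup>2 / \<theta> = (real n - real j) * (1 / \<theta> - \<theta>) + (\<theta> * \<xi> - \<eta> / \<theta>)"
      using r_eq \<theta>_pos unfolding r_def \<xi>_def \<eta>_def by (simp add: field_simps)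
    moreover have "\<bar>(real n - real j) * (1 / \<theta> - \<theta>)\<bar> \<le> s * (1 / \<theta>)"
    proof -
      have "1 / \<theta> \<ge> 1" using \<theta>_pos \<theta>_le_1 by simp
      then have "\<bar>1 / \<theta> - \<theta>\<bar> \<le> 1 / \<theta>" using \<theta>_pos \<theta>_le_1 by linarith
      moreover have "\<bar>real n - real j\<bar> \<le> s" using near(1)[OF j] B jn by simp
      ultimately show ?thesis unfolding abs_mult by (intro mult_mono) (use s_nonneg in auto)
    qed
    moreover have "\<bar>\<theta> * \<xi> - \<eta> / \<theta>\<bar> \<le> \<theta> * s + s * (1 / \<theta>)"
    proof -
      have "\<bar>\<theta> * \<xi>\<bar> \<le> \<theta> * s" "\<bar>\<eta> / \<theta>\<bar> \<le> s * (1 / \<theta>)"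
        using pointwise_\<alpha>[of j] pointwise_\<beta>[of j] \<theta>_pos
        by (auto simp: \<xi>_def \<eta>_def abs_mult abs_divide divide_right_mono)
      then show ?thesis by linarith
    qed
    moreover have "s * (1 / \<theta>) + (\<theta> * s + s * (1 / \<theta>)) \<le> 2 * \<kappa> * s"
      using s_nonneg \<theta>_pos by (simp add: \<kappa>_def algebra_simps)
    ultimately have "\<bar>\<theta> * (\<alpha> j)\<^sup>2 - (\<beta> j)\<^sup>2 / \<theta>\<bar> \<le> 2 * \<kappa> * s" by linarith
    then have "(\<theta> * (\<alpha> j)\<^sup>2 - (\<beta> j)\<^sup>2 / \<theta>)\<^sup>2 \<le> (2 * \<kappa> * s)\<^sup>2"
      by (metis abs_ge_zero power2_abs power_mono)
    then have "(\<theta> * (\<alpha> j)\<^sup>2 - (\<beta> j)\<^sup>2 / \<theta>)\<^sup>2 / c j \<le> (2 * \<kappa> * s)\<^sup>2 / (r / 4)"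
      using cj r_pos by (intro frac_le) auto
    also have "\<dots> = \<epsilon>" by (simp add: \<epsilon>_def power_mult_distrib)
    finally show ?thesis using hopping_ge[OF cj(2)] by linarith
  qed
  have var: "variation tent \<le> 2 * real B * (2 * real B)"
    unfolding variation_def
  proof (rule tent_edges)
    fix j
    have "\<bar>(tent (Suc j))\<^sup>2 - (tent j)\<^sup>2\<bar> = \<bar>tent (Suc j) - tent j\<bar> * \<bar>tent (Suc j) + tent j\<bar>"
      by (simp add: power2_eq_square algebra_simps flip: abs_mult)
    also have "\<dots> \<le> 1 * (2 * real B)"
      using tent_le[of j] tent_le[of "Suc j"] by (intro mult_mono tent_lipschitz) auto
    finally show "\<bar>(tent (Suc j))\<^sup>2 - (tent j)\<^sup>2\<bar> \<le> 2 * real B" by simp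
  qed (use B in auto)
  have grad: "gradient_part tent \<le> 2 * real B * (2 * r)"
    unfolding gradient_part_def
  proof (rule tent_edges)
    fix j assume j: "j \<le> n"
    have "(\<bar>tent j\<bar> - \<bar>tent (Suc j)\<bar>)\<^sup>2 \<le> 1"
      using tent_lipschitz[of j] tent_le[of j] tent_le[of "Suc j"]
      by (simp add: abs_square_le_1 abs_minus_commute)
    then have "c j * (\<bar>tent j\<bar> - \<bar>tent (Suc j)\<bar>)\<^sup>2 \<le> (4 * r) * 1"
      using c_upper[OF j] r_pos by (intro mult_mono) auto
    then show "c j * (\<bar>tent j\<bar> - \<bar>tent (Suc j)\<bar>)\<^sup>2 / 2 \<le> 2 * r" by simp
  qed (use B r_pos in auto)
  define N where "N = mass n tent"
  have N: "real B ^ 3 / 3 \<le> N" unfolding N_def using B by (intro tent_mass) auto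
  have mean: "(edge - 2 * \<kappa> * B - \<kappa> / 2) * N \<le> (\<Sum>j\<le>n. (edge - \<kappa> * (n - j) - \<kappa> / 2) * (tent j)\<^sup>2)"
    unfolding N_def mass_def sum_distrib_left
  proof (intro sum_mono)
    fix j assume j: "j \<in> {..n}"
    show "(edge - 2 * \<kappa> * B - \<kappa> / 2) * (tent j)\<^sup>2 \<le> (edge - \<kappa> * (n - j) - \<kappa> / 2) * (tent j)\<^sup>2"
    proof (cases "tent j = 0")
      case False
      then have "\<kappa> * (real n - real j) \<le> \<kappa> * (2 * B)"
        using near(1)[of j] \<kappa>_ge by (intro mult_left_mono) auto
      then show ?thesis using j by (intro mult_right_mono) (auto simp: of_nat_diff)
    qed simp
  qed
  have lin: "(edge - 2 * \<kappa> * B - \<kappa> / 2) * N - \<kappa> * (s / B * N + 2 * s * variation tent) \<le> linear_part tent"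
    using linear_part_close[OF dir] mean unfolding N_def by (simp add: abs_le_iff)
  have B2: "real B * real B \<le> 3 / B * N" and B1: "real B \<le> 3 / (real B)\<^sup>2 * N"
    using N Bp by (auto simp: field_simps power3_eq_cube power2_eq_square)
  have v: "\<kappa> * (2 * s * variation tent) \<le> 24 * \<kappa> * s / B * N"
  proof -
    have "\<kappa> * (2 * s * variation tent) = 2 * \<kappa> * s * variation tent" by simp
    also have "\<dots> \<le> 2 * \<kappa> * s * (4 * (real B * real B))"
      using var \<kappa>_ge s_nonneg by (intro mult_left_mono) auto
    also have "\<dots> \<le> 2 * \<kappa> * s * (4 * (3 / B * N))"
      using B2 \<kappa>_ge s_nonneg by (intro mult_left_mono) auto
    finally show ?thesis by simp
  qed
  have g: "gradient_part tent \<le> 12 * r / (real B)\<^sup>2 * N"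
  proof -
    have "4 * r * real B \<le> 4 * r * (3 / (real B)\<^sup>2 * N)"
      using B1 r_pos by (intro mult_left_mono) auto
    then show ?thesis using grad by (simp add: mult_ac)
  qed
  have "linear_part tent - gradient_part tent - \<epsilon> * N \<le> edge_form n \<alpha> \<beta> tent tent"
    unfolding N_def by (rule edge_form_ge[OF _ dir hop \<epsilon>]) (auto simp: tent_le)
  moreover have "(edge - 2 * \<kappa> * B - \<kappa> / 2 - 25 * \<kappa> * s / B - \<epsilon> - 12 * r / (real B)\<^sup>2) * N
     = (edge - 2 * \<kappa> * B - \<kappa> / 2) * N - \<kappa> * (s / B * N) - 24 * \<kappa> * s / B * N - \<epsilon> * N - 12 * r / (real B)\<^sup>2 * N"
    by (simp add: algebra_simps)
  ultimately have "(edge - 2 * \<kappa> * B - \<kappa> / 2 - 25 * \<kappa> * s / B - \<epsilon> - 12 * r / (real B)\<^sup>2) * N \<le> edge_form n \<alpha> \<beta> tent tent"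
    using lin v g unfolding distrib_left by linarith
  then show ?thesis by (simp add: \<epsilon>_def N_def)
qed

text \<open>The eigenvalue equation is used in its weak form, tested against \<open>\<phi>\<^sup>2 x\<close>. On each edge
  \<open>(\<phi>\<^sub>j - \<phi>\<^sub>j\<^sub>+\<^sub>1)\<^sup>2\<close> is what remains after completing squares.\<close>

lemma localization_identity:
  assumes dir: "dirichlet n x"
    and weak: "\<And>y. dirichlet n y \<Longrightarrow> edge_form n \<alpha> \<beta> x y = E * (\<Sum>j\<le>n. x j * y j)"
  shows "edge_form n \<alpha> \<beta> (\<lambda>j. \<phi> j * x j) (\<lambda>j. \<phi> j * x j)
     = E * mass n (\<lambda>j. \<phi> j * x j) - (\<Sum>j\<le>n. \<alpha> j * \<beta> j * (x j * x (Suc j)) * (\<phi> j - \<phi> (Suc j))\<^sup>2)"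
proof -
  have "edge_form n \<alpha> \<beta> x (\<lambda>j. (\<phi> j)\<^sup>2 * x j) = E * (\<Sum>j\<le>n. x j * ((\<phi> j)\<^sup>2 * x j))"
    by (rule weak) (use dir in \<open>simp add: dirichlet_def\<close>)
  also have "(\<Sum>j\<le>n. x j * ((\<phi> j)\<^sup>2 * x j)) = mass n (\<lambda>j. \<phi> j * x j)"
    by (simp add: mass_def power2_eq_square mult_ac)
  finally have "E * mass n (\<lambda>j. \<phi> j * x j) = edge_form n \<alpha> \<beta> x (\<lambda>j. (\<phi> j)\<^sup>2 * x j)" by simp
  then show ?thesis
    unfolding edge_form_def by (simp flip: sum_subtractf) (intro sum.cong refl, simp add: power2_eq_square algebra_simps)
qed

lemma commutator_bound:
  fixes x d :: "nat \<Rightarrow> real"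
  shows "\<bar>\<Sum>j\<le>n. \<alpha> j * \<beta> j * (x j * x (Suc j)) * d j\<bar>
     \<le> 2 * m * (\<Sum>j\<le>n. \<bar>x j * x (Suc j)\<bar> * \<bar>d j\<bar>)"
  unfolding sum_distrib_left
proof (intro order_trans[OF sum_abs] sum_mono)
  fix j assume j: "j \<in> {..n}"
  have "\<bar>\<alpha> j * \<beta> j * (x j * x (Suc j)) * d j\<bar> = \<alpha> j * \<beta> j * (\<bar>x j * x (Suc j)\<bar> * \<bar>d j\<bar>)"
    using \<alpha>_nonneg[of j] \<beta>_nonneg[of j] by (simp add: abs_mult)
  also have "\<dots> \<le> 2 * m * (\<bar>x j * x (Suc j)\<bar> * \<bar>d j\<bar>)"
    using hopping_upper[of j] j by (intro mult_right_mono) auto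
  finally show "\<bar>\<alpha> j * \<beta> j * (x j * x (Suc j)) * d j\<bar> \<le> 2 * m * (\<bar>x j * x (Suc j)\<bar> * \<bar>d j\<bar>)" by simp
qed

text \<open>The Agmon estimate. The weight \<open>\<phi>\<close> lives where the form is at most \<open>U < E\<close>, so the localization identity bounds
  \<open>(E - U)\<close> times the mass of \<open>\<phi> x\<close> by the commutator. The commutator is at most \<open>O(m \<gamma>\<^sup>2)\<close> times the mass of
  \<open>(\<phi> + 1) x\<close>, because \<open>\<phi>\<close> has logarithmic slope \<open>\<gamma>\<close>; subtracting \<open>1\<close> in the weight makes it vanish
  continuously, and the unit mass of \<open>x\<close> pays for the difference.\<close>

lemma eigenvector_decay:
  fixes K \<gamma> E :: real
  defines "\<phi> \<equiv> \<lambda>j::nat. max 0 (exp (\<gamma> * (real n - real j - K)) - 1)"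
  assumes dir: "dirichlet n x" and unit: "mass n x = 1"
    and weak: "\<And>y. dirichlet n y \<Longrightarrow> edge_form n \<alpha> \<beta> x y = E * (\<Sum>j\<le>n. x j * y j)"
    and \<gamma>: "0 < \<gamma>" "\<gamma> \<le> 1"
    and gap: "edge - \<kappa> * K / 2 + \<kappa> * s / B + 32 * \<kappa>\<^sup>2 * s\<^sup>2 / r + 24 * m * \<gamma>\<^sup>2 \<le> E"
  shows "mass n (\<lambda>j. \<phi> j * x j) \<le> 1"
proof -
  define U where "U = edge - \<kappa> * K / 2 + \<kappa> * s / B + 32 * \<kappa>\<^sup>2 * s\<^sup>2 / r"
  define N where "N = mass n (\<lambda>j. \<phi> j * x j)"
  have dir': "dirichlet n (\<lambda>j. \<phi> j * x j)" using dir by (simp add: dirichlet_def)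
  have up: "edge_form n \<alpha> \<beta> (\<lambda>j. \<phi> j * x j) (\<lambda>j. \<phi> j * x j) \<le> U * N"
    unfolding U_def N_def
  proof (rule edge_form_upper[OF dir'])
    fix j assume "\<phi> j * x j \<noteq> 0"
    then have "\<phi> j \<noteq> 0" by auto
    then have "exp (\<gamma> * (real n - real j - K)) > 1" by (simp add: \<phi>_def max_def not_le less_le split: if_splits)
    then have "\<gamma> * (real n - real j - K) > 0" by simp
    then show "K \<le> real n - real j" using \<gamma> by (simp add: zero_less_mult_iff)
  qed
  define C where "C = (\<Sum>j\<le>n. \<alpha> j * \<beta> j * (x j * x (Suc j)) * (\<phi> j - \<phi> (Suc j))\<^sup>2)"
  \<comment> \<open>The factor \<open>3\<close> bounds \<open>exp \<gamma>\<close>, the ratio of neighbouring exponentials; with it the estimate is symmetric in the two ends of the edge.\<close>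
  have slope: "(\<phi> j - \<phi> (Suc j))\<^sup>2 \<le> 3 * \<gamma>\<^sup>2 * ((\<phi> j + 1) * (\<phi> (Suc j) + 1))" for j
  proof -
    define e where "e = exp (\<gamma> * (real n - real j - K))"
    define e' where "e' = exp (\<gamma> * (real n - real (Suc j) - K))"
    have e: "e > 0" "e' > 0" "e = exp \<gamma> * e'"
      by (auto simp: e_def e'_def algebra_simps simp flip: exp_add)
    have \<phi>: "\<phi> j = max 0 (e - 1)" "\<phi> (Suc j) = max 0 (e' - 1)" by (auto simp: \<phi>_def e_def e'_def)
    have "e' \<le> e" using e \<gamma> by simp
    have "e - e' \<le> \<gamma> * e"
    proof -
      have "1 - \<gamma> \<le> exp (- \<gamma>)" using exp_ge_add_one_self[of "-\<gamma>"] by simp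
      then have "(1 - \<gamma>) * e \<le> exp (- \<gamma>) * e" using e by (intro mult_right_mono) auto
      also have "\<dots> = e'" using e by (simp add: exp_minus)
      finally show ?thesis by (simp add: algebra_simps)
    qed
    moreover have "\<bar>\<phi> j - \<phi> (Suc j)\<bar> \<le> e - e'" using \<open>e' \<le> e\<close> by (auto simp: \<phi>)
    ultimately have "\<bar>\<phi> j - \<phi> (Suc j)\<bar> \<le> \<gamma> * e" by linarith
    then have "(\<phi> j - \<phi> (Suc j))\<^sup>2 \<le> (\<gamma> * e)\<^sup>2"
      by (metis abs_ge_zero power2_abs power_mono)
    also have "\<dots> = \<gamma>\<^sup>2 * exp \<gamma> * (e * e')" using e by (simp add: power2_eq_square)
    also have "\<dots> \<le> \<gamma>\<^sup>2 * 3 * ((\<phi> j + 1) * (\<phi> (Suc j) + 1))"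
    proof (intro mult_mono)
      have "exp \<gamma> \<le> exp 1" using \<gamma> by simp
      then show "exp \<gamma> \<le> 3" using exp_le by linarith
    qed (use e in \<open>auto simp: \<phi>\<close>)
    finally show ?thesis by simp
  qed
  define z where "z = (\<lambda>j. (\<phi> j + 1) * x j)"
  have dirz: "dirichlet n z" using dir by (simp add: z_def dirichlet_def)
  have massz: "mass n z \<le> 2 * N + 2"
  proof -
    have "mass n z \<le> (\<Sum>j\<le>n. 2 * (\<phi> j * x j)\<^sup>2 + 2 * (x j)\<^sup>2)"
      unfolding mass_def
    proof (intro sum_mono)
      fix j
      show "(z j)\<^sup>2 \<le> 2 * (\<phi> j * x j)\<^sup>2 + 2 * (x j)\<^sup>2"
        using sum_squares_bound[of "\<phi> j * x j" "x j"]
        by (simp add: z_def power2_sum distrib_right)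
    qed
    also have "\<dots> = 2 * N + 2" using unit
      by (simp add: sum.distrib N_def mass_def flip: sum_distrib_left)
    finally show ?thesis .
  qed
  have "\<bar>C\<bar> \<le> 2 * m * (\<Sum>j\<le>n. \<bar>x j * x (Suc j)\<bar> * \<bar>(\<phi> j - \<phi> (Suc j))\<^sup>2\<bar>)"
    unfolding C_def by (rule commutator_bound)
  also have "\<dots> \<le> 2 * m * (\<Sum>j\<le>n. 3 * \<gamma>\<^sup>2 / 2 * ((z j)\<^sup>2 + (z (Suc j))\<^sup>2))"
  proof (intro mult_left_mono sum_mono)
    fix j
    have \<phi>0: "\<phi> i \<ge> 0" for i by (simp add: \<phi>_def)
    have "\<bar>x j * x (Suc j)\<bar> * \<bar>(\<phi> j - \<phi> (Suc j))\<^sup>2\<bar>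
        \<le> \<bar>x j * x (Suc j)\<bar> * (3 * \<gamma>\<^sup>2 * ((\<phi> j + 1) * (\<phi> (Suc j) + 1)))"
      using slope[of j] by (intro mult_left_mono) auto
    also have "\<dots> = 3 * \<gamma>\<^sup>2 * (\<bar>z j\<bar> * \<bar>z (Suc j)\<bar>)"
      using \<phi>0[of j] \<phi>0[of "Suc j"] by (simp add: z_def abs_mult)
    also have "\<dots> \<le> 3 * \<gamma>\<^sup>2 * (((z j)\<^sup>2 + (z (Suc j))\<^sup>2) / 2)"
      using sum_squares_bound[of "\<bar>z j\<bar>" "\<bar>z (Suc j)\<bar>"] by (intro mult_left_mono) auto
    finally show "\<bar>x j * x (Suc j)\<bar> * \<bar>(\<phi> j - \<phi> (Suc j))\<^sup>2\<bar> \<le> 3 * \<gamma>\<^sup>2 / 2 * ((z j)\<^sup>2 + (z (Suc j))\<^sup>2)" by simp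
  qed auto
  also have "(\<Sum>j\<le>n. 3 * \<gamma>\<^sup>2 / 2 * ((z j)\<^sup>2 + (z (Suc j))\<^sup>2)) = 3 * \<gamma>\<^sup>2 * mass n z"
    using mass_shift[OF dirz] unfolding sum_distrib_left[symmetric] sum.distrib by (simp add: mass_def)
  also have "real (2 * m) * (3 * \<gamma>\<^sup>2 * mass n z) \<le> real (2 * m) * (3 * \<gamma>\<^sup>2 * (2 * N + 2))"
    using massz by (intro mult_left_mono) auto
  finally have C: "\<bar>C\<bar> \<le> 12 * m * \<gamma>\<^sup>2 * (N + 1)" by (simp add: algebra_simps)
  have "E * N - C \<le> U * N"
    using up localization_identity[OF dir weak, of \<phi>] by (simp add: N_def C_def)
  then have 1: "(E - U) * N \<le> 12 * m * \<gamma>\<^sup>2 * (N + 1)" using C by (simp add: left_diff_distrib abs_le_iff)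
  have "24 * m * \<gamma>\<^sup>2 * N \<le> (E - U) * N"
    using gap mass_nonneg[of n] by (intro mult_right_mono) (auto simp: U_def N_def)
  then have "(12 * m * \<gamma>\<^sup>2) * N \<le> (12 * m * \<gamma>\<^sup>2) * 1"
    using 1 by (simp add: algebra_simps)
  moreover have "12 * m * \<gamma>\<^sup>2 > 0" using m_pos \<gamma> by simp
  ultimately show ?thesis unfolding N_def by (metis mult_le_cancel_left_pos)
qed

text \<open>The localization identity for a sharp cutoff: its only non-constant edge is \<open>n - p\<close>, where \<open>x\<close> is at most
  \<open>1 / h\<close>. When \<open>p = n\<close> the cut edge is the one at the empty site \<open>0\<close>.\<close>

lemma truncated_eigenvector:
  fixes K \<gamma> E :: real and p :: nat
  defines "h \<equiv> exp (\<gamma> * (real p - K)) - 1"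
  assumes dir: "dirichlet n x" and unit: "mass n x = 1"
    and weak: "\<And>y. dirichlet n y \<Longrightarrow> edge_form n \<alpha> \<beta> x y = E * (\<Sum>j\<le>n. x j * y j)"
    and \<gamma>: "0 < \<gamma>" "\<gamma> \<le> 1"
    and gap: "edge - \<kappa> * K / 2 + \<kappa> * s / B + 32 * \<kappa>\<^sup>2 * s\<^sup>2 / r + 24 * m * \<gamma>\<^sup>2 \<le> E"
    and p: "p \<le> n" and h: "h \<ge> 2"
  defines "y \<equiv> \<lambda>j. if j \<le> n - p then 0 else x j"
  shows "dirichlet n y" "mass n y > 0" "(E - 4 * m / h) * mass n y \<le> edge_form n \<alpha> \<beta> y y"
proof -
  define \<phi> where "\<phi> = (\<lambda>j::nat. max 0 (exp (\<gamma> * (real n - real j - K)) - 1))"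
  define \<psi> where "\<psi> = (\<lambda>j. if j \<le> n - p then 0 else 1 :: real)"
  have y: "y = (\<lambda>j. \<psi> j * x j)" by (auto simp: y_def \<psi>_def)
  show "dirichlet n y" using dir by (simp add: y dirichlet_def)
  have decay: "mass n (\<lambda>j. \<phi> j * x j) \<le> 1"
    unfolding \<phi>_def by (rule eigenvector_decay[OF dir unit weak \<gamma> gap])
  have "h\<^sup>2 * (\<Sum>j\<le>n - p. (x j)\<^sup>2) \<le> (\<Sum>j\<le>n - p. (\<phi> j * x j)\<^sup>2)"
    unfolding sum_distrib_left
  proof (intro sum_mono)
    fix j assume "j \<in> {..n - p}"
    then have "real p \<le> real n - real j" using p by simp
    then have "h \<le> \<phi> j" using \<gamma> by (simp add: h_def \<phi>_def le_max_iff_disj)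
    then show "h\<^sup>2 * (x j)\<^sup>2 \<le> (\<phi> j * x j)\<^sup>2"
      using h by (simp add: power_mult_distrib mult_right_mono power_mono)
  qed
  also have "\<dots> \<le> mass n (\<lambda>j. \<phi> j * x j)"
    unfolding mass_def by (intro sum_mono2) auto
  finally have small: "(\<Sum>j\<le>n - p. (x j)\<^sup>2) \<le> 1 / h\<^sup>2"
    using decay h by (simp add: field_simps)
  have "mass n x = (\<Sum>j\<le>n - p. (x j)\<^sup>2) + (\<Sum>j\<in>{..n} - {..n - p}. (x j)\<^sup>2)"
    unfolding mass_def by (subst sum.subset_diff[of "{..n - p}"]) auto
  also have "(\<Sum>j\<in>{..n} - {..n - p}. (x j)\<^sup>2) = mass n y"
    unfolding mass_def y_def by (intro sum.mono_neutral_cong_left) auto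
  finally have my: "mass n y = 1 - (\<Sum>j\<le>n - p. (x j)\<^sup>2)" using unit by simp
  have "h\<^sup>2 \<ge> 2\<^sup>2" using h by (intro power_mono) auto
  then have "1 / h\<^sup>2 \<le> 1 / 2\<^sup>2" by (intro divide_left_mono) auto
  then have my_half: "mass n y \<ge> 1 / 2" using my small by simp
  then show "mass n y > 0" by linarith
  have xq: "\<bar>x (n - p)\<bar> \<le> 1 / h"
  proof -
    have "(x (n - p))\<^sup>2 \<le> (\<Sum>j\<le>n - p. (x j)\<^sup>2)" by (intro member_le_sum) auto
    then have "\<bar>x (n - p)\<bar>\<^sup>2 \<le> (1 / h)\<^sup>2" using small by (simp add: power_divide)
    then show ?thesis by (rule power2_le_imp_le) (use h in auto)
  qed
  have xq': "\<bar>x (Suc (n - p))\<bar> \<le> 1"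
  proof (cases "Suc (n - p) \<le> n")
    case True
    then have "(x (Suc (n - p)))\<^sup>2 \<le> mass n x" unfolding mass_def by (intro member_le_sum) auto
    then show ?thesis using unit by (simp add: abs_square_le_1)
  next
    case False
    then have "Suc (n - p) = Suc n" using p by simp
    then show ?thesis using dir by (simp add: dirichlet_def)
  qed
  have "(\<Sum>j\<le>n. \<bar>x j * x (Suc j)\<bar> * \<bar>(\<psi> j - \<psi> (Suc j))\<^sup>2\<bar>) = (\<Sum>j\<in>{n - p}. \<bar>x j * x (Suc j)\<bar>)"
    by (rule sum.mono_neutral_cong_right) (auto simp: \<psi>_def)
  also have "\<dots> \<le> 1 / h * 1"
    using mult_mono[OF xq xq'] h by (simp add: abs_mult)
  finally have "2 * m * (\<Sum>j\<le>n. \<bar>x j * x (Suc j)\<bar> * \<bar>(\<psi> j - \<psi> (Suc j))\<^sup>2\<bar>) \<le> 2 * m * (1 / h)"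
    by (intro mult_left_mono) auto
  then have "\<bar>\<Sum>j\<le>n. \<alpha> j * \<beta> j * (x j * x (Suc j)) * (\<psi> j - \<psi> (Suc j))\<^sup>2\<bar> \<le> 2 * m * (1 / h)"
    using commutator_bound[of x "\<lambda>j. (\<psi> j - \<psi> (Suc j))\<^sup>2"] by linarith
  moreover have "2 * m * (1 / h) \<le> 4 * m / h * mass n y"
  proof -
    have "4 * m / h * (1 / 2) \<le> 4 * m / h * mass n y"
      using my_half h by (intro mult_left_mono) auto
    then show ?thesis by simp
  qed
  ultimately show "(E - 4 * m / h) * mass n y \<le> edge_form n \<alpha> \<beta> y y"
    using localization_identity[OF dir weak, of \<psi>] unfolding y[symmetric] left_diff_distrib
    by (simp add: y abs_le_iff)
qed

end

section \<open>The Laguerre matrix and its minors as bidiagonal forms\<close>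

text \<open>Translates the row indices of a vector, counted from \<open>0\<close>, into sites counted from \<open>1\<close>, with zeros at both ends.\<close>

definition site :: "nat \<Rightarrow> real vec \<Rightarrow> nat \<Rightarrow> real" where
  "site n v j = (if 1 \<le> j \<and> j \<le> n then v $ (j - 1) else 0)"

lemma dirichlet_site: "dirichlet n (site n v)"
  by (simp add: dirichlet_def site_def)

lemma sum_atMost_site:
  fixes f :: "nat \<Rightarrow> real"
  assumes "f 0 = 0"
  shows "(\<Sum>j\<le>n. f j) = (\<Sum>i<n. f (Suc i))"
  using assms by (simp add: sum.atMost_shift)

lemma scalar_prod_site:
  assumes "u \<in> carrier_vec n" "v \<in> carrier_vec n"
  shows "u \<bullet> v = (\<Sum>j\<le>n. site n u j * site n v j)"
  using assms by (subst sum_atMost_site) (auto simp: site_def scalar_prod_def lessThan_atLeast0 intro!: sum.cong)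

lemma mass_site: "u \<in> carrier_vec n \<Longrightarrow> mass n (site n u) = u \<bullet> u"
  by (simp add: mass_def power2_eq_square scalar_prod_site)

lemma site_vec:
  assumes "dirichlet n y" "j \<le> Suc n"
  shows "site n (vec n (\<lambda>i. y (Suc i))) j = y j"
  using assms by (cases j) (auto simp: site_def dirichlet_def le_Suc_eq)

lemma lower_bidiagonal_carrier: "lower_bidiagonal n a b \<in> carrier_mat n n"
  by (simp add: lower_bidiagonal_def)

lemma LOE_carrier: "LOE_tridiagonal n m a b \<in> carrier_mat n n"
proof -
  have "lower_bidiagonal n a b * (lower_bidiagonal n a b)\<^sup>T \<in> carrier_mat n n"
    using lower_bidiagonal_carrier by (intro mult_carrier_mat transpose_carrier_mat[THEN iffD2])
  then show ?thesis by (simp add: LOE_tridiagonal_def)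
qed

lemma LOE_symmetric: "(LOE_tridiagonal n m a b)\<^sup>T = LOE_tridiagonal n m a b"
proof -
  define L where "L = lower_bidiagonal n a b"
  have L: "L \<in> carrier_mat n n" by (simp add: L_def lower_bidiagonal_def)
  have "(L * L\<^sup>T)\<^sup>T = L * L\<^sup>T" using L by (simp add: transpose_mult[of _ n n _ n])
  moreover have "((1 / real m) \<cdot>\<^sub>m X)\<^sup>T = (1 / real m) \<cdot>\<^sub>m X\<^sup>T" for X :: "real mat"
    by (intro eq_matI) auto
  ultimately have "((1 / real m) \<cdot>\<^sub>m (L * L\<^sup>T))\<^sup>T = (1 / real m) \<cdot>\<^sub>m (L * L\<^sup>T)" by simp
  then show ?thesis by (simp add: LOE_tridiagonal_def L_def)
qed

lemma transpose_bidiagonal_mult: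
  assumes v: "v \<in> carrier_vec n" and i: "i < n"
  shows "((lower_bidiagonal n a b)\<^sup>T *\<^sub>v v) $ i = a (Suc i) * v $ i + (if Suc i < n then b (Suc i) * v $ Suc i else 0)"
proof -
  have "((lower_bidiagonal n a b)\<^sup>T *\<^sub>v v) $ i = (\<Sum>k<n. lower_bidiagonal n a b $$ (k, i) * v $ k)"
    using v i by (simp add: scalar_prod_def lower_bidiagonal_def lessThan_atLeast0)
  also have "\<dots> = (\<Sum>k<n. (if k = i then a (Suc i) * v $ i else 0) + (if k = Suc i then b (Suc i) * v $ Suc i else 0))"
    using i by (intro sum.cong refl) (auto simp: lower_bidiagonal_def)
  also have "\<dots> = a (Suc i) * v $ i + (if Suc i < n then b (Suc i) * v $ Suc i else 0)"
    using i by (simp add: sum.distrib)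
  finally show ?thesis .
qed

text \<open>Row \<open>i\<close> of \<open>B\<^sup>T v\<close> is the edge from site \<open>i + 1\<close> to site \<open>i + 2\<close>. The edge leaving the empty site \<open>0\<close>
  has no row, so its contribution \<open>\<beta> 0\<close> at site \<open>1\<close> must vanish.\<close>

lemma scalar_prod_LOE:
  assumes u: "u \<in> carrier_vec n" and v: "v \<in> carrier_vec n"
    and \<alpha>: "\<And>j. j \<in> {1..n} \<Longrightarrow> \<alpha> j = a j" and \<beta>: "\<And>j. j \<in> {1..n - 1} \<Longrightarrow> \<beta> j = b j" "\<beta> 0 = 0"
  shows "u \<bullet> (LOE_tridiagonal n m a b *\<^sub>v v) = edge_form n \<alpha> \<beta> (site n u) (site n v) / m"
proof -
  define L where "L = lower_bidiagonal n a b"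
  have L: "L \<in> carrier_mat n n" by (simp add: L_def lower_bidiagonal_def)
  have Lv: "L\<^sup>T *\<^sub>v v \<in> carrier_vec n" "L\<^sup>T *\<^sub>v u \<in> carrier_vec n" using L u v by auto
  have "(x \<cdot>\<^sub>m X) *\<^sub>v v = x \<cdot>\<^sub>v (X *\<^sub>v v)" if "X \<in> carrier_mat n n" for x :: real and X
    using v that by (intro eq_vecI) (auto simp: scalar_prod_def sum_distrib_left mult.assoc)
  moreover have "L * L\<^sup>T \<in> carrier_mat n n" using L by auto
  ultimately have "LOE_tridiagonal n m a b *\<^sub>v v = (1 / real m) \<cdot>\<^sub>v ((L * L\<^sup>T) *\<^sub>v v)"
    by (simp add: LOE_tridiagonal_def L_def[symmetric])
  then have "u \<bullet> (LOE_tridiagonal n m a b *\<^sub>v v) = (u \<bullet> (L *\<^sub>v (L\<^sup>T *\<^sub>v v))) / m"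
    using L u v by (simp add: assoc_mult_mat_vec[of _ n n _ n])
  also have "u \<bullet> (L *\<^sub>v (L\<^sup>T *\<^sub>v v)) = (L\<^sup>T *\<^sub>v u) \<bullet> (L\<^sup>T *\<^sub>v v)"
    using transpose_vec_mult_scalar[OF L Lv(1) u] by simp
  also have "\<dots> = (\<Sum>i<n. (L\<^sup>T *\<^sub>v u) $ i * (L\<^sup>T *\<^sub>v v) $ i)"
    using carrier_vecD[OF Lv(1)] unfolding scalar_prod_def by (simp only: lessThan_atLeast0)
  also have "\<dots> = (\<Sum>i<n. (\<alpha> (Suc i) * site n u (Suc i) + \<beta> (Suc i) * site n u (Suc (Suc i)))
        * (\<alpha> (Suc i) * site n v (Suc i) + \<beta> (Suc i) * site n v (Suc (Suc i))))"
    using u v \<alpha> \<beta> by (intro sum.cong refl) (auto simp: L_def transpose_bidiagonal_mult site_def)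
  also have "\<dots> = edge_form n \<alpha> \<beta> (site n u) (site n v)"
    unfolding edge_form_def using \<beta> by (subst sum_atMost_site) (auto simp: site_def)
  finally show ?thesis .
qed

lemma bottom_right_minor_eq:
  assumes A: "A \<in> carrier_mat n n" and p: "p \<le> n"
  shows "bottom_right_minor p A = mat p p (\<lambda>(i, j). A $$ (n - p + i, n - p + j))"
proof -
  have set_eq: "{i. i < n \<and> n - p \<le> i \<and> i < n} = {n - p..<n}" by auto
  have below: "{x \<in> {n - p..<n}. x < n - p + i} = {n - p..<n - p + i}" if "i < p" for i
    using that p by auto
  have dims: "dim_row (bottom_right_minor p A) = p" "dim_col (bottom_right_minor p A) = p"
    using A p by (simp_all add: bottom_right_minor_def dim_submatrix set_eq)
  show ?thesis
  proof (rule eq_matI)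
    fix i j assume ij: "i < dim_row (mat p p (\<lambda>(i, j). A $$ (n - p + i, n - p + j)))"
      "j < dim_col (mat p p (\<lambda>(i, j). A $$ (n - p + i, n - p + j)))"
    then have ij: "i < p" "j < p" by auto
    have "submatrix A {n - p..<n} {n - p..<n} $$ (card {x \<in> {n - p..<n}. x < n - p + i}, card {x \<in> {n - p..<n}. x < n - p + j})
        = A $$ (n - p + i, n - p + j)"
      by (rule submatrix_index_card) (use A p ij in auto)
    then show "bottom_right_minor p A $$ (i, j) = mat p p (\<lambda>(i, j). A $$ (n - p + i, n - p + j)) $$ (i, j)"
      unfolding below[OF ij(1)] below[OF ij(2)] using A ij by (simp add: bottom_right_minor_def)
  qed (simp_all add: dims)
qed

text \<open>Vectors of the minor are the vectors of the whole space whose first \<open>n - p\<close> entries vanish.\<close>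

lemma minor_quadratic_form:
  assumes A: "A \<in> carrier_mat n n" and p: "p \<le> n" and w: "w \<in> carrier_vec n"
    and w0: "\<And>i. i < n - p \<Longrightarrow> w $ i = (0 :: real)"
  defines "u \<equiv> vec p (\<lambda>i. w $ (n - p + i))"
  shows "u \<bullet> (bottom_right_minor p A *\<^sub>v u) = w \<bullet> (A *\<^sub>v w)" and "u \<bullet> u = w \<bullet> w"
proof -
  have drop: "(\<Sum>i<n. f i) = (\<Sum>i<p. f (n - p + i))" if "\<And>i. i < n - p \<Longrightarrow> f i = 0" for f :: "nat \<Rightarrow> real"
  proof -
    have "(\<Sum>i<n. f i) = (\<Sum>i\<in>{n - p..<n}. f i)"
      using that by (intro sum.mono_neutral_right) auto
    also have "\<dots> = (\<Sum>i<p. f (n - p + i))"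
      using sum.shift_bounds_nat_ivl[of f 0 "n - p" p] p by (simp add: lessThan_atLeast0 add.commute)
    finally show ?thesis .
  qed
  have B: "bottom_right_minor p A \<in> carrier_mat p p" by (simp add: bottom_right_minor_eq[OF A p])
  have u: "u \<in> carrier_vec p" by (simp add: u_def)
  have "w \<bullet> (A *\<^sub>v w) = (\<Sum>i<p. \<Sum>j<n. A $$ (n - p + i, j) * w $ (n - p + i) * w $ j)"
    unfolding scalar_prod_quadratic[OF A w w] by (rule drop) (simp add: w0)
  also have "\<dots> = (\<Sum>i<p. \<Sum>j<p. A $$ (n - p + i, n - p + j) * w $ (n - p + i) * w $ (n - p + j))"
    by (intro sum.cong refl drop) (simp add: w0)
  also have "\<dots> = u \<bullet> (bottom_right_minor p A *\<^sub>v u)"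
    unfolding scalar_prod_quadratic[OF B u u] by (simp add: bottom_right_minor_eq[OF A p] u_def)
  finally show "u \<bullet> (bottom_right_minor p A *\<^sub>v u) = w \<bullet> (A *\<^sub>v w)" by simp
  have "w \<bullet> w = (\<Sum>i<n. w $ i * w $ i)" using w by (simp add: scalar_prod_def lessThan_atLeast0)
  also have "\<dots> = (\<Sum>i<p. w $ (n - p + i) * w $ (n - p + i))" by (rule drop) (simp add: w0)
  also have "\<dots> = u \<bullet> u" by (simp add: u_def scalar_prod_def lessThan_atLeast0)
  finally show "u \<bullet> u = w \<bullet> w" by simp
qed

lemma bottom_right_minor_symmetric:
  assumes A: "A \<in> carrier_mat n n" "A\<^sup>T = A" and p: "p \<le> n"
  shows "bottom_right_minor p A \<in> carrier_mat p p" "(bottom_right_minor p A)\<^sup>T = bottom_right_minor p A"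
proof -
  have "A $$ (i, j) = A $$ (j, i)" if "i < n" "j < n" for i j
    using that A by (metis carrier_matD index_transpose_mat(1))
  then show "bottom_right_minor p A \<in> carrier_mat p p" "(bottom_right_minor p A)\<^sup>T = bottom_right_minor p A"
    using p by (auto simp: bottom_right_minor_eq[OF A(1) p] intro!: eq_matI)
qed

lemma minor_eigenvalue_ge:
  fixes A :: "real mat"
  assumes A: "A \<in> carrier_mat n n" "A\<^sup>T = A" and p: "0 < p" "p \<le> n"
    and w: "w \<in> carrier_vec n" "\<And>i. i < n - p \<Longrightarrow> w $ i = 0"
  shows "w \<bullet> (A *\<^sub>v w) \<le> largest_eigenvalue (bottom_right_minor p A) * (w \<bullet> w)"
  using largest_eigenvalue_variational(2)[OF bottom_right_minor_symmetric[OF A p(2)] p(1), of "vec p (\<lambda>i. w $ (n - p + i))"]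
    minor_quadratic_form[OF A(1) p(2) w] by simp

lemma minor_eigenvalue_le:
  fixes A :: "real mat"
  assumes A: "A \<in> carrier_mat n n" "A\<^sup>T = A" and p: "0 < p" "p \<le> n"
  shows "largest_eigenvalue (bottom_right_minor p A) \<le> largest_eigenvalue A"
proof -
  define D where "D = bottom_right_minor p A"
  obtain v where v: "v \<in> carrier_vec p" "v \<bullet> v = 1" "D *\<^sub>v v = largest_eigenvalue D \<cdot>\<^sub>v v"
    using largest_eigenvalue_variational(1)[OF bottom_right_minor_symmetric[OF A p(2)] p(1)] by (auto simp: D_def)
  define w where "w = vec n (\<lambda>i. if i < n - p then 0 else v $ (i - (n - p)))"
  have w: "w \<in> carrier_vec n" "\<And>i. i < n - p \<Longrightarrow> w $ i = 0" by (auto simp: w_def)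
  have v_eq: "vec p (\<lambda>i. w $ (n - p + i)) = v"
    using v(1) p by (intro eq_vecI) (auto simp: w_def)
  have "largest_eigenvalue D = v \<bullet> (D *\<^sub>v v)" unfolding v(3) using v(1,2) by simp
  also have "\<dots> = w \<bullet> (A *\<^sub>v w)"
    using minor_quadratic_form(1)[OF A(1) p(2) w] by (simp add: v_eq D_def)
  also have "\<dots> \<le> largest_eigenvalue A * (w \<bullet> w)"
    using p by (intro largest_eigenvalue_variational(2)[OF A] w) auto
  also have "w \<bullet> w = 1" using minor_quadratic_form(2)[OF A(1) p(2) w] v by (simp add: v_eq)
  finally show ?thesis by (simp add: D_def)
qed

lemma window_bounded_extension:
  assumes "window_bounded n B s x" and "L \<le> B" and "\<And>i. y i = (if i \<in> {1..n} then x i else 0)"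
  shows "\<bar>\<Sum>i\<in>{u..<u + L}. y i\<bar> \<le> s"
proof -
  have "(\<Sum>i\<in>{u..<u + L}. y i) = (\<Sum>i\<in>{u..<u + L} \<inter> {1..n}. x i)"
    unfolding assms(3) by (subst sum.inter_restrict) auto
  moreover have "{u..<u + L} \<inter> {1..n} = {}" if "\<not> u \<le> n" using that by auto
  moreover have "0 \<le> s" using assms(1)[unfolded window_bounded_def, rule_format, of 0 0] by simp
  ultimately show ?thesis
    using assms(1,2) by (cases "u \<le> n") (auto simp: window_bounded_def simp del: One_nat_def)
qed

text \<open>The numerical condition \<open>gap\<close> is the comparison of the tent bound with the far field bound, divided by \<open>\<kappa>\<close>
  and with \<open>\<theta>\<close> eliminated through \<open>3 \<le> \<kappa> \<le> 3 + R\<close> and \<open>n \<le> r \<le> R n\<close>.\<close>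

lemma LOE_minor_close:
  fixes a b :: "nat \<Rightarrow> real" and s K \<gamma> R :: real
  assumes a: "\<And>i. i \<in> {1..n} \<Longrightarrow> 0 \<le> a i" and b: "\<And>i. i \<in> {1..n - 1} \<Longrightarrow> 0 \<le> b i"
    and wa: "window_bounded n B s (\<lambda>i. (a i)\<^sup>2 - real (m - n + i))"
    and wb: "window_bounded (n - 1) B s (\<lambda>i. (b i)\<^sup>2 - real i)"
    and nm: "n \<le> m" "m \<le> R * n" and n: "n \<ge> 4" and B: "B \<ge> 1" "4 * B \<le> n" "2 * real B \<le> s"
    and s: "32 * s \<le> n" and \<gamma>: "0 < \<gamma>" "\<gamma> \<le> 1" and p: "0 < p" "p \<le> n"
    and gap: "2 * B + 1 / 2 + 26 * s / B + 48 * (3 + R) * s\<^sup>2 / n + 4 * R * n / (real B)\<^sup>2 + 8 * R * n * \<gamma>\<^sup>2 \<le> K / 2"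
    and h: "exp (\<gamma> * (real p - K)) - 1 \<ge> h" "h \<ge> 2"
  defines "A \<equiv> LOE_tridiagonal n m a b"
  shows "\<bar>largest_eigenvalue A - largest_eigenvalue (bottom_right_minor p A)\<bar> \<le> 4 / h"
proof -
  define \<theta> where "\<theta> = sqrt (n / m)"
  \<comment> \<open>Outside the matrix the coefficients are set to the square roots of the means, so that the noise there is zero.\<close>
  define \<alpha> where "\<alpha> = (\<lambda>j. if j \<in> {1..n} then a j else sqrt (real m - real n + real j))"
  define \<beta> where "\<beta> = (\<lambda>j. if j \<in> {1..n - 1} then b j else sqrt (real j))"
  have m: "m > 0" using n nm by simp
  interpret noisy_bidiagonal n m B s \<theta> \<alpha> \<beta>
  proof
    show "0 \<le> \<alpha> j" "0 \<le> \<beta> j" for j using a b nm by (auto simp: \<alpha>_def \<beta>_def)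
    show "\<bar>\<Sum>i\<in>{u..<u + L}. (\<alpha> i)\<^sup>2 - (real m - real n + real i)\<bar> \<le> s" if "L \<le> B" for u L
      by (rule window_bounded_extension[OF wa that]) (use nm in \<open>auto simp: \<alpha>_def of_nat_diff\<close>)
    show "\<bar>\<Sum>i\<in>{u..<u + L}. (\<beta> i)\<^sup>2 - real i\<bar> \<le> s" if "L \<le> B" for u L
      by (rule window_bounded_extension[OF wb that]) (auto simp: \<beta>_def)
  qed (use n nm B s m in \<open>auto simp: \<theta>_def\<close>)
  have A: "A \<in> carrier_mat n n" "A\<^sup>T = A" by (simp_all add: A_def LOE_carrier LOE_symmetric)
  have n0: "0 < n" using n by simp
  have form: "u \<bullet> (A *\<^sub>v v) = edge_form n \<alpha> \<beta> (site n u) (site n v) / m"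
    if "u \<in> carrier_vec n" "v \<in> carrier_vec n" for u v
    unfolding A_def by (rule scalar_prod_LOE[OF that]) (auto simp: \<alpha>_def \<beta>_def)
  obtain v where v: "v \<in> carrier_vec n" "v \<bullet> v = 1" "A *\<^sub>v v = largest_eigenvalue A \<cdot>\<^sub>v v"
    using largest_eigenvalue_variational(1)[OF A n0] by blast
  define x where "x = site n v"
  define E where "E = m * largest_eigenvalue A"
  have dir: "dirichlet n x" by (simp add: x_def dirichlet_site)
  have unit: "mass n x = 1" using v by (simp add: x_def mass_site)
  have form_vec: "edge_form n \<alpha> \<beta> f (site n (vec n (\<lambda>i. y (Suc i)))) = edge_form n \<alpha> \<beta> f y"
    "edge_form n \<alpha> \<beta> (site n (vec n (\<lambda>i. y (Suc i)))) f = edge_form n \<alpha> \<beta> y f"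
    if "dirichlet n y" for f y
    unfolding edge_form_def by (auto intro!: sum.cong simp: site_vec[OF that])
  have mass_vec: "vec n (\<lambda>i. y (Suc i)) \<bullet> vec n (\<lambda>i. y (Suc i)) = mass n y"
    if "dirichlet n y" for y
    unfolding mass_site[of "vec n (\<lambda>i. y (Suc i))" n, simplified, symmetric] mass_def
    by (auto intro!: sum.cong simp: site_vec[OF that])
  have weak: "edge_form n \<alpha> \<beta> x y = E * (\<Sum>j\<le>n. x j * y j)" if y: "dirichlet n y" for y
  proof -
    define u where "u = vec n (\<lambda>i. y (Suc i))"
    have u: "u \<in> carrier_vec n" by (simp add: u_def)
    have "edge_form n \<alpha> \<beta> y x = m * (u \<bullet> (A *\<^sub>v v))"
      using form[OF u v(1)] form_vec(2)[OF y] m by (simp add: u_def x_def)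
    also have "u \<bullet> (A *\<^sub>v v) = largest_eigenvalue A * (u \<bullet> v)" using u v by simp
    also have "u \<bullet> v = (\<Sum>j\<le>n. x j * y j)"
    proof -
      have "u \<bullet> v = (\<Sum>j\<le>n. site n u j * site n v j)" by (rule scalar_prod_site[OF u v(1)])
      also have "\<dots> = (\<Sum>j\<le>n. x j * y j)"
        unfolding x_def u_def by (auto intro!: sum.cong simp: site_vec[OF y])
      finally show ?thesis .
    qed
    finally show ?thesis by (simp add: E_def edge_form_def mult_ac)
  qed
  have top: "edge_form n \<alpha> \<beta> y y \<le> E * mass n y" if y: "dirichlet n y" for y
  proof -
    define u where "u = vec n (\<lambda>i. y (Suc i))"
    have u: "u \<in> carrier_vec n" by (simp add: u_def)
    have "u \<bullet> (A *\<^sub>v u) \<le> largest_eigenvalue A * (u \<bullet> u)"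
      by (rule largest_eigenvalue_variational(2)[OF A n0 u])
    then show ?thesis
      using m unfolding form[OF u u] unfolding u_def form_vec[OF y] mass_vec[OF y] E_def
      by (simp add: field_simps)
  qed
  have R: "R \<ge> 1"
  proof -
    have "1 * real n \<le> R * real n" using nm by simp
    then show ?thesis by (rule mult_right_le_imp_le) (use n0 in simp)
  qed
  have rm: "r \<le> R * n" "n \<le> r"
    using n_le_r \<theta>_le_1 \<theta>_pos nm mult_right_mono[of \<theta> 1 "real m"] by (auto simp: r_def)
  have \<kappa>: "\<kappa> \<le> 3 + R"
  proof -
    have "1 / \<theta> = r / n" using r_eq n0 \<theta>_pos by (simp add: field_simps)
    also have "\<dots> \<le> R" using rm n0 by (simp add: field_simps)
    finally show ?thesis using \<theta>_le_1 by (simp add: \<kappa>_def)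
  qed
  have gap': "edge - \<kappa> * K / 2 + \<kappa> * s / B + 32 * \<kappa>\<^sup>2 * s\<^sup>2 / r + 24 * m * \<gamma>\<^sup>2
     \<le> edge - 2 * \<kappa> * B - \<kappa> / 2 - 25 * \<kappa> * s / B - 16 * \<kappa>\<^sup>2 * s\<^sup>2 / r - 12 * r / (real B)\<^sup>2"
  proof -
    have 1: "48 * \<kappa>\<^sup>2 * s\<^sup>2 / r \<le> \<kappa> * (48 * (3 + R) * s\<^sup>2 / n)"
    proof -
      have "48 * \<kappa>\<^sup>2 * s\<^sup>2 / r \<le> 48 * \<kappa>\<^sup>2 * s\<^sup>2 / n"
        using rm n0 by (intro divide_left_mono) auto
      also have "\<dots> = (48 * s\<^sup>2 / n * \<kappa>) * \<kappa>" by (simp add: power2_eq_square)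
      also have "\<dots> \<le> (48 * s\<^sup>2 / n * \<kappa>) * (3 + R)"
        using \<kappa> \<kappa>_ge by (intro mult_left_mono) auto
      also have "\<dots> = \<kappa> * (48 * (3 + R) * s\<^sup>2 / n)"
        by (simp only: times_divide_eq_left times_divide_eq_right mult_ac)
      finally show ?thesis .
    qed
    have 2: "12 * r / (real B)\<^sup>2 \<le> \<kappa> * (4 * R * n / (real B)\<^sup>2)"
    proof -
      have "12 * r / (real B)\<^sup>2 \<le> 12 * (R * n) / (real B)\<^sup>2" using rm by (intro divide_right_mono mult_left_mono) auto
      also have "\<dots> = 3 * (4 * R * n / (real B)\<^sup>2)" by simp
      also have "\<dots> \<le> \<kappa> * (4 * R * n / (real B)\<^sup>2)" using R \<kappa>_ge by (intro mult_right_mono) auto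
      finally show ?thesis .
    qed
    have 3: "24 * m * \<gamma>\<^sup>2 \<le> \<kappa> * (8 * R * n * \<gamma>\<^sup>2)"
    proof -
      have "24 * m * \<gamma>\<^sup>2 \<le> 24 * (R * n) * \<gamma>\<^sup>2" using nm by (intro mult_right_mono mult_left_mono) auto
      also have "\<dots> = 3 * (8 * R * n * \<gamma>\<^sup>2)" by simp
      also have "\<dots> \<le> \<kappa> * (8 * R * n * \<gamma>\<^sup>2)" using R \<kappa>_ge by (intro mult_right_mono) auto
      finally show ?thesis .
    qed
    have "\<kappa> * (2 * B + 1 / 2 + 26 * s / B + 48 * (3 + R) * s\<^sup>2 / n + 4 * R * n / (real B)\<^sup>2 + 8 * R * n * \<gamma>\<^sup>2) \<le> \<kappa> * (K / 2)"
      using gap \<kappa>_ge by (intro mult_left_mono) auto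
    then have "\<kappa> * (2 * B) + \<kappa> * (1 / 2) + \<kappa> * (26 * s / B) + \<kappa> * (48 * (3 + R) * s\<^sup>2 / n)
       + \<kappa> * (4 * R * n / (real B)\<^sup>2) + \<kappa> * (8 * R * n * \<gamma>\<^sup>2) \<le> \<kappa> * (K / 2)"
      by (simp only: distrib_left)
    moreover have "\<kappa> * (26 * s / B) = \<kappa> * s / B + 25 * \<kappa> * s / B"
      "48 * \<kappa>\<^sup>2 * s\<^sup>2 / r = 32 * \<kappa>\<^sup>2 * s\<^sup>2 / r + 16 * \<kappa>\<^sup>2 * s\<^sup>2 / r"
      "\<kappa> * (2 * B) = 2 * \<kappa> * B" "\<kappa> * (1 / 2) = \<kappa> / 2" "\<kappa> * (K / 2) = \<kappa> * K / 2"
      by (simp_all add: field_simps)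
    ultimately show ?thesis using 1 2 3 by linarith
  qed
  have "2 * B \<le> n" using B by simp
  then have tm: "mass n tent > 0" using tent_mass B by (smt (verit) of_nat_0_less_iff zero_less_divide_iff zero_less_power One_nat_def Suc_le_eq)
  have "(edge - 2 * \<kappa> * B - \<kappa> / 2 - 25 * \<kappa> * s / B - 16 * \<kappa>\<^sup>2 * s\<^sup>2 / r - 12 * r / (real B)\<^sup>2) * mass n tent \<le> E * mass n tent"
    using edge_form_tent[OF B(2,3)] top[OF tent_dirichlet[OF \<open>2 * B \<le> n\<close>]] by linarith
  then have "edge - 2 * \<kappa> * B - \<kappa> / 2 - 25 * \<kappa> * s / B - 16 * \<kappa>\<^sup>2 * s\<^sup>2 / r - 12 * r / (real B)\<^sup>2 \<le> E"
    using tm by (rule mult_right_le_imp_le)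
  with gap' have gapE: "edge - \<kappa> * K / 2 + \<kappa> * s / B + 32 * \<kappa>\<^sup>2 * s\<^sup>2 / r + 24 * m * \<gamma>\<^sup>2 \<le> E" by linarith
  define h' where "h' = exp (\<gamma> * (real p - K)) - 1"
  have h': "h \<le> h'" "h' \<ge> 2" using h by (auto simp: h'_def)
  define y where "y = (\<lambda>j. if j \<le> n - p then 0 else x j)"
  have y: "dirichlet n y" "mass n y > 0" "(E - 4 * m / h') * mass n y \<le> edge_form n \<alpha> \<beta> y y"
    using truncated_eigenvector[OF dir unit weak \<gamma> gapE p(2), folded h'_def y_def] h' by auto
  define u where "u = vec n (\<lambda>i. y (Suc i))"
  have u: "u \<in> carrier_vec n" "\<And>i. i < n - p \<Longrightarrow> u $ i = 0" by (auto simp: u_def y_def)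
  define \<mu>' where "\<mu>' = largest_eigenvalue (bottom_right_minor p A)"
  have "u \<bullet> (A *\<^sub>v u) \<le> \<mu>' * (u \<bullet> u)"
    unfolding \<mu>'_def by (rule minor_eigenvalue_ge[OF A p u])
  then have "edge_form n \<alpha> \<beta> y y \<le> m * \<mu>' * mass n y"
    using m unfolding form[OF u(1) u(1)] unfolding u_def form_vec[OF y(1)] mass_vec[OF y(1)]
    by (simp add: field_simps)
  with y(3) have "(E - 4 * m / h') * mass n y \<le> m * \<mu>' * mass n y" by linarith
  then have "E - 4 * m / h' \<le> m * \<mu>'" using y(2) by (rule mult_right_le_imp_le)
  then have "m * (largest_eigenvalue A - 4 / h') \<le> m * \<mu>'" by (simp add: E_def right_diff_distrib mult.commute)
  then have "largest_eigenvalue A - 4 / h' \<le> \<mu>'" using m by simp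
  moreover have "4 / h' \<le> 4 / h" using h h' by (intro divide_left_mono) auto
  moreover have "\<mu>' \<le> largest_eigenvalue A" unfolding \<mu>'_def by (rule minor_eigenvalue_le[OF A p])
  ultimately show ?thesis unfolding \<mu>'_def by linarith
qed

section \<open>The scales, and the comparison with high probability\<close>

lemma LOE_entry_measurable:
  assumes E: "LOE_entries n m M a b" and ij: "i < n" "j < n"
  shows "(\<lambda>w. LOE_tridiagonal n m (\<lambda>i. a i w) (\<lambda>i. b i w) $$ (i, j)) \<in> borel_measurable M"
proof -
  interpret prob_space M using E by (simp add: LOE_entries_def)
  have rv: "random_variable borel (case_sum a b q)" if "q \<in> {1..n} <+> {1..n - 1}" for q
    using E that by (auto simp: LOE_entries_def indep_vars_def)
  have a: "a k \<in> borel_measurable M" if "k \<in> {1..n}" for k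
    using rv[OF InlI[OF that]] by simp
  have b: "b k \<in> borel_measurable M" if "k \<in> {1..n - 1}" for k
    using rv[OF InrI[OF that]] by simp
  have L: "(\<lambda>w. lower_bidiagonal n (\<lambda>i. a i w) (\<lambda>i. b i w) $$ (i, k)) \<in> borel_measurable M"
    if "i < n" "k < n" for i k
    using that a[of "Suc i"] b[of "Suc k"] by (cases "i = k"; cases "i = Suc k") (auto simp: lower_bidiagonal_def)
  have "(\<lambda>w. LOE_tridiagonal n m (\<lambda>i. a i w) (\<lambda>i. b i w) $$ (i, j))
      = (\<lambda>w. 1 / real m * (\<Sum>k<n. lower_bidiagonal n (\<lambda>i. a i w) (\<lambda>i. b i w) $$ (i, k)
            * lower_bidiagonal n (\<lambda>i. a i w) (\<lambda>i. b i w) $$ (j, k)))"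
    using ij by (auto simp: LOE_tridiagonal_def scalar_prod_def lessThan_atLeast0 lower_bidiagonal_def intro!: ext sum.cong)
  also have "\<dots> \<in> borel_measurable M"
    using L ij by (intro borel_measurable_times borel_measurable_const borel_measurable_sum) auto
  finally show ?thesis .
qed

text \<open>The comparison holds off the exceptional event. Measurability of both eigenvalues is needed to pass from this inclusion
  to the probability of the set in the conclusion.\<close>

lemma LOE_minor_close_probability:
  fixes s t K \<gamma> R h :: real
  assumes E: "LOE_entries n m M a b"
    and nm: "n \<le> m" "m \<le> R * n" and n: "n \<ge> 4" and B: "B \<ge> 1" "4 * B \<le> n" "2 * real B \<le> s"
    and s: "32 * s \<le> n" and \<gamma>: "0 < \<gamma>" "\<gamma> \<le> 1" and p: "0 < p" "p \<le> n"
    and gap: "2 * B + 1 / 2 + 26 * s / B + 48 * (3 + R) * s\<^sup>2 / n + 4 * R * n / (real B)\<^sup>2 + 8 * R * n * \<gamma>\<^sup>2 \<le> K / 2"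
    and h: "exp (\<gamma> * (real p - K)) - 1 \<ge> h" "h \<ge> 2" and t: "0 \<le> t" "t \<le> 1 / 4" and d: "4 / h \<le> d"
  defines "A \<equiv> \<lambda>w. LOE_tridiagonal n m (\<lambda>i. a i w) (\<lambda>i. b i w)"
  shows "1 - (real n + 1) * (real B + 1) * (4 * exp (- t * s + 4 * t\<^sup>2 * (real m * real B)))
    \<le> measure M {w \<in> space M. \<bar>largest_eigenvalue (A w) - largest_eigenvalue (bottom_right_minor p (A w))\<bar> \<le> d}"
proof -
  interpret prob_space M using E by (simp add: LOE_entries_def)
  define bad where "bad = {w \<in> space M. \<not> (window_bounded n B s (\<lambda>i. (a i w)\<^sup>2 - real (m - n + i)) \<and>
                                window_bounded (n - 1) B s (\<lambda>i. (b i w)\<^sup>2 - real i))}"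
  define S where "S = {w \<in> space M. \<bar>largest_eigenvalue (A w) - largest_eigenvalue (bottom_right_minor p (A w))\<bar> \<le> d}"
  have n1: "1 \<le> n" "0 < n" using n by auto
  have bad: "bad \<in> events" "prob bad \<le> (real n + 1) * (real B + 1) * (4 * exp (- t * s + 4 * t\<^sup>2 * (real m * real B)))"
    unfolding bad_def by (rule LOE_noise_windows[OF E nm(1) n1(1) t])+
  have A: "A w \<in> carrier_mat n n" "(A w)\<^sup>T = A w" for w
    by (simp_all add: A_def LOE_carrier LOE_symmetric)
  have [measurable]: "(\<lambda>w. largest_eigenvalue (A w)) \<in> borel_measurable M"
    by (rule borel_measurable_largest_eigenvalue[OF A n1(2)]) (simp add: A_def LOE_entry_measurable[OF E])
  have [measurable]: "(\<lambda>w. largest_eigenvalue (bottom_right_minor p (A w))) \<in> borel_measurable M"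
  proof (rule borel_measurable_largest_eigenvalue[OF bottom_right_minor_symmetric[OF A p(2)] p(1)])
    fix i j assume ij: "i < p" "j < p"
    then have "bottom_right_minor p (A w) $$ (i, j) = A w $$ (n - p + i, n - p + j)" for w
      by (simp add: bottom_right_minor_eq[OF A(1) p(2)])
    then show "(\<lambda>w. bottom_right_minor p (A w) $$ (i, j)) \<in> borel_measurable M"
      using ij p by (simp add: A_def LOE_entry_measurable[OF E])
  qed
  have S: "S \<in> events" unfolding S_def by measurable
  have "space M - bad \<subseteq> S"
  proof
    fix w assume w: "w \<in> space M - bad"
    have "\<bar>largest_eigenvalue (A w) - largest_eigenvalue (bottom_right_minor p (A w))\<bar> \<le> 4 / h"
      unfolding A_def
      by (rule LOE_minor_close[where s = s and B = B, OF _ _ _ _ nm n B s \<gamma> p gap h])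
         (use w E in \<open>auto simp: bad_def LOE_entries_def\<close>)
    then show "w \<in> S" using w d by (simp add: S_def)
  qed
  then have "prob (space M - bad) \<le> prob S" by (intro finite_measure_mono S)
  moreover have "prob (space M - bad) = 1 - prob bad" using bad(1) by (rule prob_compl)
  ultimately show ?thesis using bad(2) unfolding S_def by linarith
qed

text \<open>The thresholds are those required by \<open>scale_estimates\<close>, where \<open>N\<close> is \<open>n\<^sup>1\<^sup>/\<^sup>3\<close> and \<open>L\<close> is \<open>log n\<close>.\<close>

lemma scales_eventually:
  fixes R :: real and D \<epsilon> :: real
  assumes R: "R \<ge> 1" and \<epsilon>: "\<epsilon> > 0"
  defines "N \<equiv> \<lambda>n::nat. real n powr (1/3)"
  defines "L \<equiv> \<lambda>n::nat. ln (real n)"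
  shows "\<forall>\<^sub>F n in sequentially. 4 \<le> n \<and> 4 \<le> N n \<and> 96 * L n \<le> N n \<and> 1 \<le> L n
     \<and> 2 * (83 + 432 * (3 + R) + 12 * R) \<le> L n
     \<and> D * L n + 3 \<le> L n ^ 3 \<and> 16 * exp (8 * R) \<le> \<epsilon> * n"
proof -
  have L: "filterlim L at_top sequentially" unfolding L_def by real_asymp
  have N: "filterlim N at_top sequentially" unfolding N_def by real_asymp
  have 1: "\<forall>\<^sub>F n in sequentially. 4 \<le> (n::nat)" by (rule eventually_ge_at_top)
  have 2: "\<forall>\<^sub>F n in sequentially. 4 \<le> N n" using N by (auto simp: filterlim_at_top)
  have 3: "\<forall>\<^sub>F n in sequentially. 96 * L n \<le> N n" unfolding L_def N_def by real_asymp
  have 4: "\<forall>\<^sub>F n in sequentially. max 1 (2 * (83 + 432 * (3 + R) + 12 * R)) \<le> L n"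
    using L unfolding filterlim_at_top by blast
  have 5: "\<forall>\<^sub>F n in sequentially. \<bar>D\<bar> + 3 \<le> L n" using L by (auto simp: filterlim_at_top)
  have "filterlim (\<lambda>n::nat. real n) at_top sequentially" by (rule filterlim_real_sequentially)
  then have 6: "\<forall>\<^sub>F n in sequentially. 16 * exp (8 * R) / \<epsilon> \<le> real n" by (auto simp: filterlim_at_top)
  show ?thesis
    using 1 2 3 4 5 6
  proof eventually_elim
    case (elim n)
    have "D * L n + 3 \<le> L n ^ 3"
    proof -
      have L1: "1 \<le> L n" using elim by simp
      have "D * L n \<le> \<bar>D\<bar> * L n" using L1 by (intro mult_right_mono) auto
      then have "D * L n + 3 \<le> (\<bar>D\<bar> + 3) * L n" using L1 unfolding distrib_right by linarith
      also have "\<dots> \<le> L n * L n" using elim L1 by (intro mult_right_mono) auto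
      also have "\<dots> \<le> L n * L n * L n" using L1 by (simp add: mult_le_cancel_left1)
      finally show ?thesis by (simp add: power3_eq_cube)
    qed
    then show ?case using elim \<epsilon> by (simp add: field_simps)
  qed
qed

text \<open>The choice of scales. Windows have length about \<open>N\<close>. The Chernoff parameter \<open>t = N\<^sup>-\<^sup>2\<close> keeps the quadratic term
  \<open>t\<^sup>2 m B\<close> bounded and turns \<open>s = 3 N\<^sup>2 L\<close> into the probability \<open>n\<^sup>-\<^sup>3\<close>, which
  survives the union over at most \<open>4 n\<^sup>2\<close> windows in each of the two sequences. All errors are then \<open>O(N L\<^sup>2)\<close>, which \<open>K = N L\<^sup>3\<close> dominates, and the decay over the
  further distance \<open>K\<close> at rate \<open>\<gamma> = 1 / N\<close> is \<open>exp (- L\<^sup>3)\<close>.\<close>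

lemma scale_estimates:
  fixes R D \<epsilon> N L s \<gamma> t K :: real and n m B :: nat
  defines "N \<equiv> real n powr (1/3)" and "L \<equiv> ln (real n)"
  defines "B \<equiv> nat \<lceil>N\<rceil>" and "s \<equiv> 3 * N\<^sup>2 * L" and "\<gamma> \<equiv> 1 / N" and "t \<equiv> 1 / N\<^sup>2" and "K \<equiv> N * L ^ 3"
  assumes R: "R \<ge> 1" and m: "real m \<le> R * n"
    and n: "4 \<le> n" and N: "4 \<le> N" "96 * L \<le> N" and L: "1 \<le> L"
    "2 * (83 + 432 * (3 + R) + 12 * R) \<le> L" and D: "D * L + 3 \<le> L ^ 3" and \<epsilon>: "16 * exp (8 * R) \<le> \<epsilon> * n"
  shows "B \<ge> 1" "4 * B \<le> n" "2 * real B \<le> s" "32 * s \<le> n" "0 < \<gamma>" "\<gamma> \<le> 1" "0 \<le> t" "t \<le> 1 / 4"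
    and "2 * B + 1 / 2 + 26 * s / B + 48 * (3 + R) * s\<^sup>2 / n + 4 * R * n / (real B)\<^sup>2 + 8 * R * n * \<gamma>\<^sup>2 \<le> K / 2"
    and "\<And>p::nat. 2 * K < p \<Longrightarrow> exp (L ^ 3) - 1 \<le> exp (\<gamma> * (real p - K)) - 1"
    and "2 \<le> exp (L ^ 3) - 1" "4 / (exp (L ^ 3) - 1) \<le> real n powr (- D)"
    and "(real n + 1) * (real B + 1) * (4 * exp (- t * s + 4 * t\<^sup>2 * (real m * real B))) \<le> \<epsilon>"
proof -
  have n0: "real n > 0" using n by simp
  have N3: "real n = N ^ 3" unfolding N_def using n0 by (simp add: powr_powr flip: powr_numeral)
  have N0: "N > 0" using N by simp
  have BN: "N \<le> B" "B \<le> N + 1" using N0 unfolding B_def by linarith+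
  have N2: "N\<^sup>2 \<ge> 16" using N power_mono[of 4 N 2] by simp
  show B1: "B \<ge> 1" using BN N by linarith
  have "4 * real B \<le> 8 * N" using BN N by simp
  also have "\<dots> \<le> N\<^sup>2 * N" using N2 N0 by (intro mult_right_mono) auto
  finally show "4 * B \<le> n" using N3 by (simp add: power3_eq_cube power2_eq_square)
  have sN: "3 * N\<^sup>2 \<le> s" using L(1) N0 by (simp add: s_def mult_le_cancel_left1)
  have "2 * real B \<le> 4 * N" using BN N by simp
  also have "\<dots> \<le> N * N" using N by (intro mult_right_mono) auto
  also have "\<dots> \<le> s" using sN N0 zero_le_power2[of N] unfolding power2_eq_square by linarith
  finally show "2 * real B \<le> s" .
  have "32 * s = N\<^sup>2 * (96 * L)" by (simp add: s_def)
  also have "\<dots> \<le> N\<^sup>2 * N" using N by (intro mult_left_mono) auto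
  finally show "32 * s \<le> n" using N3 by (simp add: power3_eq_cube power2_eq_square)
  show "0 < \<gamma>" "\<gamma> \<le> 1" using N by (auto simp: \<gamma>_def)
  show "0 \<le> t" "t \<le> 1 / 4"
    using N2 N0 by (auto simp: t_def pos_divide_le_eq)
  show "2 * B + 1 / 2 + 26 * s / B + 48 * (3 + R) * s\<^sup>2 / n + 4 * R * n / (real B)\<^sup>2 + 8 * R * n * \<gamma>\<^sup>2 \<le> K / 2"
  proof -
    have L2: "1 \<le> L\<^sup>2" "L \<le> L\<^sup>2" using L by (auto simp: power2_eq_square mult_le_cancel_left1 mult_ge1_I)
    have s0: "s \<ge> 0" using L N0 by (simp add: s_def)
    have a: "2 * real B + 1 / 2 \<le> 5 * N" using BN N by simp
    have b: "26 * s / B \<le> 78 * (N * L)"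
    proof -
      have "26 * s / B \<le> 26 * s / N" using BN N0 s0 by (intro divide_left_mono) auto
      also have "\<dots> = 78 * (N * L)" using N0 by (simp add: s_def power2_eq_square)
      finally show ?thesis .
    qed
    have c: "48 * (3 + R) * s\<^sup>2 / n = 432 * (3 + R) * (N * L\<^sup>2)"
      unfolding N3 s_def using N0 by (simp add: field_simps power2_eq_square power3_eq_cube)
    have d: "4 * R * n / (real B)\<^sup>2 \<le> 4 * R * N"
    proof -
      have "4 * R * n / (real B)\<^sup>2 \<le> 4 * R * n / N\<^sup>2"
        using BN N0 R by (intro divide_left_mono power_mono) auto
      also have "\<dots> = 4 * R * N" unfolding N3 using N0 by (simp add: power2_eq_square power3_eq_cube)
      finally show ?thesis .
    qed
    have e: "8 * R * n * \<gamma>\<^sup>2 = 8 * R * N"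
      unfolding N3 \<gamma>_def using N0 by (simp add: power2_eq_square power3_eq_cube field_simps)
    have "2 * real B + 1 / 2 + 26 * s / B + 48 * (3 + R) * s\<^sup>2 / n + 4 * R * n / (real B)\<^sup>2 + 8 * R * n * \<gamma>\<^sup>2
        \<le> 5 * N + 78 * (N * L) + 432 * (3 + R) * (N * L\<^sup>2) + 4 * R * N + 8 * R * N"
      using a b c d e by linarith
    also have "\<dots> = N * (5 + 78 * L + 432 * (3 + R) * L\<^sup>2 + 12 * R)" by (simp add: algebra_simps)
    also have "\<dots> \<le> N * (5 * L\<^sup>2 + 78 * L\<^sup>2 + 432 * (3 + R) * L\<^sup>2 + 12 * R * L\<^sup>2)"
      using L2 R N0 by (intro mult_left_mono add_mono) (auto simp: mult_le_cancel_left1)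
    also have "\<dots> = N * L\<^sup>2 * (83 + 432 * (3 + R) + 12 * R)" by (simp add: algebra_simps)
    also have "\<dots> \<le> N * L\<^sup>2 * (L / 2)" using L N0 by (intro mult_left_mono) auto
    also have "\<dots> = K / 2" by (simp add: K_def power2_eq_square power3_eq_cube)
    finally show ?thesis by simp
  qed
  show "exp (L ^ 3) - 1 \<le> exp (\<gamma> * (real p - K)) - 1" if "2 * K < p" for p :: nat
  proof -
    have "L ^ 3 = \<gamma> * K" using N0 by (simp add: \<gamma>_def K_def)
    also have "\<dots> \<le> \<gamma> * (real p - K)" using that \<open>0 < \<gamma>\<close> by (intro mult_left_mono) auto
    finally show ?thesis by simp
  qed
  have e3: "exp (3::real) \<ge> 8"
  proof -
    have "(2::real) ^ 3 \<le> exp 1 ^ 3" using exp_ge_add_one_self[of 1] by (intro power_mono) auto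
    then show ?thesis by (simp flip: exp_of_nat_mult)
  qed
  have big: "8 * exp (max D 0 * L) \<le> exp (L ^ 3)"
  proof -
    have "3 \<le> L ^ 3"
    proof -
      have "3 \<le> L" using L R by simp
      also have "L \<le> L ^ 3" using L by (simp add: power3_eq_cube mult_le_cancel_left1 mult_ge1_I)
      finally show ?thesis .
    qed
    then have "max D 0 * L + 3 \<le> L ^ 3" using D by (auto simp: max_def)
    have "8 * exp (max D 0 * L) \<le> exp 3 * exp (max D 0 * L)" using e3 by (intro mult_right_mono) auto
    also have "\<dots> = exp (max D 0 * L + 3)" by (simp add: exp_add)
    also have "\<dots> \<le> exp (L ^ 3)" using \<open>max D 0 * L + 3 \<le> L ^ 3\<close> by simp
    finally show ?thesis .
  qed
  have one: "1 \<le> exp (max D 0 * L)" using L by simp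
  show "2 \<le> exp (L ^ 3) - 1" using big one by linarith
  have "4 * exp (D * L) \<le> exp (L ^ 3) - 1"
  proof -
    have "exp (D * L) \<le> exp (max D 0 * L)" using L by (simp add: mult_right_mono)
    then show ?thesis using big one by linarith
  qed
  then have "4 / (exp (L ^ 3) - 1) \<le> 4 / (4 * exp (D * L))"
    by (intro frac_le) auto
  also have "\<dots> = real n powr (- D)" using n0 by (simp add: powr_def L_def exp_minus field_simps)
  finally show "4 / (exp (L ^ 3) - 1) \<le> real n powr (- D)" .
  have "(real n + 1) * (real B + 1) * (4 * exp (- t * s + 4 * t\<^sup>2 * (real m * real B)))
      \<le> (2 * real n) * (2 * real n) * (4 * (1 / real n ^ 3 * exp (8 * R)))"
  proof (intro mult_mono)
    have "real B + 1 \<le> 2 * N" using BN N by simp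
    also have "\<dots> \<le> 2 * real n" using N unfolding N3 by (simp add: power3_eq_cube mult_le_cancel_left1 mult_ge1_I)
    finally show "real B + 1 \<le> 2 * real n" .
    have ts: "t * s = 3 * L" using N0 by (simp add: t_def s_def)
    have "4 * t\<^sup>2 * (real m * real B) \<le> 4 * t\<^sup>2 * (R * n * (2 * N))"
      using m BN N by (intro mult_left_mono mult_mono) auto
    also have "\<dots> = 8 * R" unfolding N3 t_def using N0 by (simp add: power2_eq_square power3_eq_cube)
    finally have "exp (- t * s + 4 * t\<^sup>2 * (real m * real B)) \<le> exp (- (3 * L) + 8 * R)" using ts by simp
    also have "\<dots> = exp (- (3 * L)) * exp (8 * R)" by (rule exp_add)
    also have "exp (- (3 * L)) = 1 / real n ^ 3"
      using n0 by (simp add: exp_minus L_def exp_of_nat_mult[of 3, simplified] divide_inverse)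
    finally show "exp (- t * s + 4 * t\<^sup>2 * (real m * real B)) \<le> 1 / real n ^ 3 * exp (8 * R)" .
  qed (use n in auto)
  also have "\<dots> = 16 * exp (8 * R) / n" using n0 by (simp add: field_simps power3_eq_cube)
  also have "\<dots> \<le> \<epsilon>" using \<epsilon> n0 by (simp add: field_simps)
  finally show "(real n + 1) * (real B + 1) * (4 * exp (- t * s + 4 * t\<^sup>2 * (real m * real B))) \<le> \<epsilon>" .
qed

theorem lemma5p2:
  fixes l :: real
    and m p :: "nat \<Rightarrow> nat"
    and M :: "nat \<Rightarrow> 'w measure"
    and a b :: "nat \<Rightarrow> nat \<Rightarrow> 'w \<Rightarrow> real"
    and \<mu> \<mu>' T Y :: "nat \<Rightarrow> 'w \<Rightarrow> real"
  assumes l: "0 < l" "l \<le> 1"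
    and n_le_m: "\<And>n. n \<le> m n"
    and ratio: "(\<lambda>n. real n / real (m n) - l) \<in> O(\<lambda>n. 1 / real n)"
    and entries: "\<And>n. LOE_entries n (m n) (M n) (a n) (b n)"
    and p: "\<forall>\<^sub>F n in sequentially.
              2 * real n powr (1/3) * (ln (real n)) ^ 3 < real (p n) \<and> p n \<le> n"
    and \<mu>: "\<And>n w. \<mu> n w =
              largest_eigenvalue (LOE_tridiagonal n (m n) (\<lambda>i. a n i w) (\<lambda>i. b n i w))"
    and \<mu>': "\<And>n w. \<mu>' n w =
              largest_eigenvalue (bottom_right_minor (p n)
                (LOE_tridiagonal n (m n) (\<lambda>i. a n i w) (\<lambda>i. b n i w)))"
    and T: "\<And>n w. T n w = edge_scaling l n (\<mu> n w)"
    and Y: "\<And>n w. Y n w = edge_scaling l n (\<mu>' n w)"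
  shows "(\<forall>D>0. \<forall>\<epsilon>>0. \<exists>C>0. \<forall>\<^sub>F n in sequentially.
            measure (M n) {w \<in> space (M n). \<bar>\<mu> n w - \<mu>' n w\<bar> \<le> C * real n powr (- D)} \<ge> 1 - \<epsilon>) \<and>
         (\<forall>D>2/3. \<forall>\<epsilon>>0. \<exists>C>0. \<forall>\<^sub>F n in sequentially.
            measure (M n) {w \<in> space (M n). \<bar>T n w - Y n w\<bar> \<le> C * real n powr (- D + 2/3)} \<ge> 1 - \<epsilon>)"
proof -
  define R where "R = 2 / l"
  have R: "R \<ge> 1" using l by (simp add: R_def)
  have m_upper: "\<forall>\<^sub>F n in sequentially. real (m n) \<le> R * n"
  proof -
    obtain c where c: "\<forall>\<^sub>F n in sequentially. norm (real n / real (m n) - l) \<le> c * norm (1 / real n)"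
      using landau_o.bigE[OF ratio] by blast
    have "(\<lambda>n. c * norm (1 / real n)) \<longlonglongrightarrow> c * norm (0 :: real)"
      by (intro tendsto_intros lim_1_over_n)
    then have "(\<lambda>n. real n / real (m n) - l) \<longlonglongrightarrow> 0"
      by (intro Lim_null_comparison[OF c]) simp
    then have "\<forall>\<^sub>F n in sequentially. \<bar>real n / real (m n) - l\<bar> < l / 2"
      using l by (auto dest!: tendstoD[where e = "l / 2"] simp: dist_real_def)
    then show ?thesis
    proof eventually_elim
      case (elim n)
      then have *: "l / 2 < real n / real (m n)" by linarith
      then have "m n > 0" using l by (cases "m n = 0") auto
      then show ?case using * l by (simp add: R_def field_simps)
    qed
  qed
  \<comment> \<open>Since \<open>4 / (exp ((ln n)\<^sup>3) - 1)\<close> is below every power of \<open>n\<close>, no constant is lost before rescaling.\<close>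
  have core: "\<forall>\<^sub>F n in sequentially.
      measure (M n) {w \<in> space (M n). \<bar>\<mu> n w - \<mu>' n w\<bar> \<le> real n powr (- D)} \<ge> 1 - \<epsilon>"
    if \<epsilon>: "\<epsilon> > 0" for D \<epsilon>
    using scales_eventually[OF R \<epsilon>, of D] m_upper p
  proof eventually_elim
    case (elim n)
    have n: "4 \<le> n" and mR: "real (m n) \<le> R * n" using elim by auto
    note est = scale_estimates[of R "m n" n D \<epsilon>, OF R mR n]
    have pn: "2 * (real n powr (1/3) * ln (real n) ^ 3) < real (p n)" "p n \<le> n"
      using elim by (auto simp: mult.assoc)
    have "0 \<le> real n powr (1/3) * ln (real n) ^ 3" using elim by auto
    then have p0: "0 < p n" using pn(1) by simp
    have "1 - \<epsilon> \<le> 1 - (real n + 1) * (real (nat \<lceil>real n powr (1/3)\<rceil>) + 1) * (4 * exp (- (1 / (real n powr (1/3))\<^sup>2) * (3 * (real n powr (1/3))\<^sup>2 * ln (real n))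
        + 4 * (1 / (real n powr (1/3))\<^sup>2)\<^sup>2 * (real (m n) * real (nat \<lceil>real n powr (1/3)\<rceil>))))"
      using est(13) elim by simp
    also have "\<dots> \<le> measure (M n) {w \<in> space (M n). \<bar>\<mu> n w - \<mu>' n w\<bar> \<le> real n powr (- D)}"
      unfolding \<mu> \<mu>'
      by (rule LOE_minor_close_probability[OF entries n_le_m mR n, where K = "real n powr (1/3) * ln (real n) ^ 3"
            and \<gamma> = "1 / real n powr (1/3)" and h = "exp (ln (real n) ^ 3) - 1"])
         (use est elim pn p0 in simp_all)
    finally show ?case .
  qed
  define c where "c = 1 / (sqrt l * (1 + sqrt l) powr (4/3))"
  have "1 + sqrt l > 0" using l by (simp add: add_pos_nonneg)
  then have c: "c > 0" using l by (simp add: c_def)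
  show ?thesis
  proof (intro conjI allI impI)
    fix D \<epsilon> :: real assume "\<epsilon> > 0"
    from core[OF this, of D] show "\<exists>C>0. \<forall>\<^sub>F n in sequentially.
        measure (M n) {w \<in> space (M n). \<bar>\<mu> n w - \<mu>' n w\<bar> \<le> C * real n powr (- D)} \<ge> 1 - \<epsilon>"
      by (intro exI[of _ 1]) simp
  next
    fix D \<epsilon> :: real assume "\<epsilon> > 0"
    have "\<forall>\<^sub>F n in sequentially.
        measure (M n) {w \<in> space (M n). \<bar>T n w - Y n w\<bar> \<le> c * real n powr (- D + 2/3)} \<ge> 1 - \<epsilon>"
      using core[OF \<open>\<epsilon> > 0\<close>, of D] eventually_gt_at_top[of 0]
    proof eventually_elim
      case (elim n)
      have fac: "c * real n powr (2/3) > 0" using c elim by simp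
      have "(\<bar>T n w - Y n w\<bar> \<le> c * real n powr (- D + 2/3)) \<longleftrightarrow> (\<bar>\<mu> n w - \<mu>' n w\<bar> \<le> real n powr (- D))" for w
      proof -
        have "T n w - Y n w = c * real n powr (2/3) * (\<mu> n w - \<mu>' n w)"
          by (simp add: T Y edge_scaling_def c_def diff_divide_distrib[symmetric] algebra_simps)
        then have "\<bar>T n w - Y n w\<bar> = c * real n powr (2/3) * \<bar>\<mu> n w - \<mu>' n w\<bar>"
          using abs_mult[of "c * real n powr (2/3)" "\<mu> n w - \<mu>' n w"] abs_of_pos[OF fac] by (simp only:)
        moreover have "c * real n powr (- D + 2/3) = c * real n powr (2/3) * real n powr (- D)"
          by (simp only: powr_add mult_ac)
        ultimately show ?thesis using mult_le_cancel_left_pos[OF fac] by (simp only:)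
      qed
      then show ?case using elim by simp
    qed
    with c show "\<exists>C>0. \<forall>\<^sub>F n in sequentially.
        measure (M n) {w \<in> space (M n). \<bar>T n w - Y n w\<bar> \<le> C * real n powr (- D + 2/3)} \<ge> 1 - \<epsilon>"
      by blast
  qed
qed

end
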